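(* For every $w\in W$, let $(I,J)=(\{i_1>\dots>i_k>0\},\{j_1>\dots>j_k\ge 0\})$ be the Frobenius symbol of the partition $\lambda$ corresponding to $w(\Lambda_0)$. Then the normalized function $\widetilde\phi_w(\Lambda_0)$ is given by the determinant $$\widetilde\phi_w(\Lambda_0)=\det\bigl(\widetilde\phi_{p,q}\bigr)_{p\in I,\,q\in J}=\det\bigl(\widetilde\phi_{i_a,j_b}\bigr)_{1\le a,b\le k}.$$
   Context: Field and group action. Let $K=\mathbf{C}(\alpha;f;\tau)$ be the field of rational functions in infinitely many independent variables $\alpha_i,f_i,\tau_i$ $(i\in\mathbf{Z})$. For each $i\in\mathbf{Z}$ let $s_i$ be the field automorphism of $K$ (over $\mathbf{C}$) with $s_i(\alpha_i)=-\alpha_i$, $s_i(\alpha_{i\pm1})=\alpha_{i\pm1}+\alpha_i$, $s_i(\alpha_j)=\alpha_j$ $(j\ne i,i\pm1)$; $s_i(f_i)=f_i$, $s_i(f_{i\pm1})=f_{i\pm1}\pm\alpha_i/f_i$, $s_i(f_j)=f_j$ $(j\neq i,i\pm1)$; $s_i(\tau_i)=f_i\tau_{i-1}\tau_{i+1}/\tau_i$, $s_i(\tau_j)=\tau_j$ $(j\ne i)$. These satisfy $s_i^2=1$, $(s_is_{i+1})^3=1$, $s_is_j=s_js_i$ $(j\ne i\pm1)$ and so define an action on $K$ of the Weyl group $W=W(A_\infty)$ (the Coxeter group with generators $s_i$, $i\in\mathbf Z$, and these relations). Weights. $W$ also acts on the free $\mathbf Z$-module with basis $\Lambda_i$ $(i\in\mathbf{Z})$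 by $s_i(\Lambda_i)=\Lambda_{i+1}+\Lambda_{i-1}-\Lambda_i$, $s_i(\Lambda_j)=\Lambda_j$ $(j\ne i)$. Put $v_i=\Lambda_i-\Lambda_{i-1}$; then $s_i$ swaps $v_i$ and $v_{i+1}$ and fixes the other $v_j$, so $W$ is identified with the group of finitely supported permutations of $\mathbf{Z}$, via $w(v_j)=v_{\sigma_w(j)}$. Formally $\Lambda_0=\sum_{j\le0}v_j$ and $w(\Lambda_0)=\sum_{i\in M}v_i$ with $M=\sigma_w(\mathbf{Z}_{\le0})$ (the Maya diagram); $M$ depends only on $w(\Lambda_0)$. In formulas in $K$, differences $v_a-v_b$ are read through $\alpha_i=v_i-v_{i+1}$, i.e. $v_a-v_b=\alpha_a+\dots+\alpha_{b-1}$ for $a<b$. Partitions. A partition $\lambda=(\lambda_1\ge\dots\ge\lambda_l>0)$ is identified with its Young diagram $Y=\{(i,j):1\le i\le l,\ 1\le j\le\lambda_i\}$; $\lambda'$ is the transposed partition. Its Frobenius symbol is $(I,J)=(\{i_1>\dots>i_k>0\},\{j_1>\dots>j_k\ge0\})$, $i_n=\lambda_n-n+1$, $j_n=\lambda'_n-n$, $k=\max\{n:\lambda_n\ge n\}$ ($I=J=\emptyset$ for the empty partition). The partition corresponding to $w(\Lambda_0)$ is the one whose Frobenius symbol satisfies $I=M\cap\mathbf{Z}_{>0}$ and $-J=\mathbf{Z}_{\le0}\setminus M$ (that is, $M\cup(-J)=\mathbf{Z}_{\le0}\cup I$ as disjoint unions). Functions. For $w\in W$, $\phi_w(\Lambda_0)\in\mathbf{C}(\alpha;f)$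 is defined by $w(\tau_0)=\phi_w(\Lambda_0)\prod_{i\in\mathbf{Z}}\tau_i^{m_i}$, where $m_i\in\{0,\pm1\}$ is the coefficient of $\Lambda_i$ in $w(\Lambda_0)$. With $\lambda=Y$ corresponding to $w(\Lambda_0)$, put $N_w=\prod_{(i,j)\in Y}\bigl(v_{j-\lambda'_j}-v_{\lambda_i-i+1}\bigr)$ and $\widetilde\phi_w(\Lambda_0)=\phi_w(\Lambda_0)/N_w$. Hooks. For $p\ge1$, $q\ge0$ put $w_{p,q}=(s_{-q}\cdots s_{-2}s_{-1})(s_{p-1}\cdots s_1s_0)$, for which $w_{p,q}(\Lambda_0)$ corresponds to the hook with Frobenius symbol $(\{p\},\{q\})$, and $\widetilde\phi_{p,q}=\widetilde\phi_{w_{p,q}}(\Lambda_0)$. The empty determinant is $1$. *)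

theory Defs
  imports
    Complex_Main
    "HOL-Library.Poly_Mapping"
    "HOL-Library.Countable"
    "HOL-Computational_Algebra.Fraction_Field"
    "Jordan_Normal_Form.Determinant"
begin

section \<open>The field of rational functions\<close>

datatype indet = Alpha int | F int | Tau int

text \<open>The order on indeterminates is arbitrary; it is only there because the library derives
  \<^class>\<open>idom\<close> for polynomials from a linear order on the exponents.\<close>

instance indet :: countable
  by countable_datatype

instantiation indet :: linorder
begin

definition less_eq_indet :: "indet \<Rightarrow> indet \<Rightarrow> bool" where
  "less_eq_indet x y \<longleftrightarrow> to_nat x \<le> to_nat y"

definition less_indet :: "indet \<Rightarrow> indet \<Rightarrow> bool" where
  "less_indet x y \<longleftrightarrow> to_nat x < to_nat y"

instance
  by standard (auto simp: less_eq_indet_def less_indet_def)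

end

type_synonym mpol = "(indet \<Rightarrow>\<^sub>0 nat) \<Rightarrow>\<^sub>0 complex"
type_synonym ratfun = "mpol fract"

definition cpol :: "complex \<Rightarrow> mpol" where
  "cpol c = Poly_Mapping.single 0 c"

definition xpol :: "indet \<Rightarrow> mpol" where
  "xpol x = Poly_Mapping.single (Poly_Mapping.single x 1) 1"

definition const :: "complex \<Rightarrow> ratfun" where
  "const c = to_fract (cpol c)"

definition gen :: "indet \<Rightarrow> ratfun" where
  "gen x = to_fract (xpol x)"

abbreviation \<alpha> :: "int \<Rightarrow> ratfun" where "\<alpha> i \<equiv> gen (Alpha i)"
abbreviation \<ff> :: "int \<Rightarrow> ratfun" where "\<ff> i \<equiv> gen (F i)"
abbreviation \<tau> :: "int \<Rightarrow> ratfun" where "\<tau> i \<equiv> gen (Tau i)"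

definition C_hom :: "(ratfun \<Rightarrow> ratfun) \<Rightarrow> bool" where
  "C_hom \<phi> \<longleftrightarrow> field_hom \<phi> \<and> (\<forall>c. \<phi> (const c) = const c)"

definition C_automorphism :: "(ratfun \<Rightarrow> ratfun) \<Rightarrow> bool" where
  "C_automorphism \<phi> \<longleftrightarrow> C_hom \<phi> \<and> bij \<phi>"

lemma poly_mapping_sum_singles: "p = (\<Sum>m\<in>Poly_Mapping.keys p. Poly_Mapping.single m (Poly_Mapping.lookup p m))"
proof (rule poly_mapping_eqI)
  fix k
  have "Poly_Mapping.lookup (\<Sum>m\<in>Poly_Mapping.keys p. Poly_Mapping.single m (Poly_Mapping.lookup p m)) k
    = (\<Sum>m\<in>Poly_Mapping.keys p. if m = k then Poly_Mapping.lookup p m else 0)"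
    by (simp add: lookup_sum lookup_single when_def)
  also have "\<dots> = Poly_Mapping.lookup p k"
    by (simp add: sum.delta in_keys_iff)
  finally show "Poly_Mapping.lookup p k = Poly_Mapping.lookup (\<Sum>m\<in>Poly_Mapping.keys p. Poly_Mapping.single m (Poly_Mapping.lookup p m)) k" ..
qed

lemma single_mpol_induct:
  assumes c: "\<And>c. P (cpol c)" and x: "\<And>x. P (xpol x)"
    and m: "\<And>p q. P p \<Longrightarrow> P q \<Longrightarrow> P (p * q)"
  shows "P (Poly_Mapping.single m c)"
proof -
  have pw: "P (Poly_Mapping.single (Poly_Mapping.single x n) 1)" for x n
  proof (induction n)
    case 0
    show ?case using c[of 1] by (simp add: cpol_def)
  next
    case (Suc n)
    show ?case using m[OF x[of x] Suc]
      by (simp add: xpol_def mult_single single_add[symmetric])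
  qed
  have fs: "P (Poly_Mapping.single (\<Sum>x\<in>A. Poly_Mapping.single x (g x)) 1)" if "finite A" for A g
    using that
  proof (induction A)
    case empty
    show ?case using c[of 1] by (simp add: cpol_def)
  next
    case (insert a A)
    show ?case using m[OF pw[of a "g a"] insert(3)] insert(1,2)
      by (simp add: mult_single)
  qed
  have "P (Poly_Mapping.single m 1)"
    using fs[of "Poly_Mapping.keys m" "Poly_Mapping.lookup m"] by (simp flip: poly_mapping_sum_singles)
  from m[OF c[of c] this] show ?thesis by (simp add: cpol_def mult_single)
qed

lemma mpol_induct [case_names const gen add mult]:
  assumes c: "\<And>c. P (cpol c)" and x: "\<And>x. P (xpol x)"
    and a: "\<And>p q. P p \<Longrightarrow> P q \<Longrightarrow> P (p + q)"
    and m: "\<And>p q. P p \<Longrightarrow> P q \<Longrightarrow> P (p * q)"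
  shows "P p"
proof -
  have s: "P (Poly_Mapping.single m c)" for m c
    by (rule single_mpol_induct) (use c x m in auto)
  have "P (\<Sum>m\<in>A. Poly_Mapping.single m (g m))" if "finite A" for A g
    using that
  proof (induction A)
    case empty
    show ?case using c[of 0] by (simp add: cpol_def)
  next
    case (insert a A)
    then show ?case using s a by simp
  qed
  from this[of "Poly_Mapping.keys p" "Poly_Mapping.lookup p"] show ?thesis
    by (simp flip: poly_mapping_sum_singles)
qed

lemma ratfun_cases:
  fixes x :: ratfun
  obtains a b :: mpol where "b \<noteq> 0" "x = to_fract a / to_fract b"
proof (cases x)
  case (Fract a b)
  then show ?thesis using that[of b a] by (simp add: to_fract_def)
qed

lemma C_hom_unique:
  assumes h: "C_hom \<phi>" and k: "C_hom \<psi>" and eq: "\<And>x. \<phi> (gen x) = \<psi> (gen x)"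
  shows "\<phi> = \<psi>"
proof
  interpret h: field_hom \<phi> using h by (simp add: C_hom_def)
  interpret k: field_hom \<psi> using k by (simp add: C_hom_def)
  fix x :: ratfun
  have p: "\<phi> (to_fract p) = \<psi> (to_fract p)" for p
  proof (induction p rule: mpol_induct)
    case (const c)
    then show ?case using h k by (simp add: C_hom_def const_def[symmetric])
  next
    case (gen x)
    then show ?case using eq by (simp add: gen_def[symmetric])
  qed (simp_all add: h.hom_add k.hom_add h.hom_mult k.hom_mult)
  obtain a b where "b \<noteq> 0" "x = to_fract a / to_fract b" by (rule ratfun_cases[of x])
  then show "\<phi> x = \<psi> x" by (simp add: h.hom_div k.hom_div p)
qed

definition mon :: "(indet \<Rightarrow> ratfun) \<Rightarrow> (indet \<Rightarrow>\<^sub>0 nat) \<Rightarrow> ratfun" where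
  "mon g m = (\<Prod>x\<in>Poly_Mapping.keys m. g x ^ Poly_Mapping.lookup m x)"

definition ev :: "(indet \<Rightarrow> ratfun) \<Rightarrow> mpol \<Rightarrow> ratfun" where
  "ev g p = (\<Sum>m\<in>Poly_Mapping.keys p. const (Poly_Mapping.lookup p m) * mon g m)"

lemma const_0 [simp]: "const 0 = 0" and const_1 [simp]: "const 1 = 1"
  by (simp_all add: const_def cpol_def)

lemma const_add: "const (a + b) = const a + const b"
  by (simp add: const_def cpol_def single_add flip: to_fract_add)

lemma const_mult: "const (a * b) = const a * const b"
  by (simp add: const_def cpol_def mult_single flip: to_fract_mult)

lemma mon_superset:
  "finite S \<Longrightarrow> Poly_Mapping.keys m \<subseteq> S \<Longrightarrow> mon g m = (\<Prod>x\<in>S. g x ^ Poly_Mapping.lookup m x)"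
  unfolding mon_def by (rule prod.mono_neutral_left) (auto simp: in_keys_iff)

lemma mon_add: "mon g (m + n) = mon g m * mon g n"
proof -
  let ?S = "Poly_Mapping.keys m \<union> Poly_Mapping.keys n"
  have "mon g (m + n) = (\<Prod>x\<in>?S. g x ^ Poly_Mapping.lookup (m + n) x)"
    by (rule mon_superset) (use Poly_Mapping.keys_add[of m n] in auto)
  also have "\<dots> = (\<Prod>x\<in>?S. g x ^ Poly_Mapping.lookup m x) * (\<Prod>x\<in>?S. g x ^ Poly_Mapping.lookup n x)"
    by (simp add: lookup_add power_add prod.distrib)
  also have "(\<Prod>x\<in>?S. g x ^ Poly_Mapping.lookup m x) = mon g m"
    by (rule mon_superset[symmetric]) auto
  also have "(\<Prod>x\<in>?S. g x ^ Poly_Mapping.lookup n x) = mon g n"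
    by (rule mon_superset[symmetric]) auto
  finally show ?thesis .
qed

lemma ev_superset:
  "finite S \<Longrightarrow> Poly_Mapping.keys p \<subseteq> S \<Longrightarrow> ev g p = (\<Sum>m\<in>S. const (Poly_Mapping.lookup p m) * mon g m)"
  unfolding ev_def by (rule sum.mono_neutral_left) (auto simp: in_keys_iff)

lemma ev_add: "ev g (p + q) = ev g p + ev g q"
proof -
  let ?S = "Poly_Mapping.keys p \<union> Poly_Mapping.keys q"
  have "ev g (p + q) = (\<Sum>m\<in>?S. const (Poly_Mapping.lookup (p + q) m) * mon g m)"
    by (rule ev_superset) (use Poly_Mapping.keys_add[of p q] in auto)
  also have "\<dots> = (\<Sum>m\<in>?S. const (Poly_Mapping.lookup p m) * mon g m)
      + (\<Sum>m\<in>?S. const (Poly_Mapping.lookup q m) * mon g m)"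
    by (simp add: lookup_add const_add distrib_right sum.distrib)
  also have "(\<Sum>m\<in>?S. const (Poly_Mapping.lookup p m) * mon g m) = ev g p"
    by (rule ev_superset[symmetric]) auto
  also have "(\<Sum>m\<in>?S. const (Poly_Mapping.lookup q m) * mon g m) = ev g q"
    by (rule ev_superset[symmetric]) auto
  finally show ?thesis .
qed

lemma ev_single: "ev g (Poly_Mapping.single m c) = const c * mon g m"
  by (simp add: ev_def)

lemma ev_0 [simp]: "ev g 0 = 0"
  by (simp add: ev_def)

lemma mon_0 [simp]: "mon g 0 = 1"
  by (simp add: mon_def)

lemma ev_sum: "ev g (\<Sum>i\<in>A. h i) = (\<Sum>i\<in>A. ev g (h i))"
  by (induction A rule: infinite_finite_induct) (simp_all add: ev_add)

lemma ev_mult: "ev g (p * q) = ev g p * ev g q"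
proof -
  let ?s = "\<lambda>p m. Poly_Mapping.single m (Poly_Mapping.lookup p m)"
  have e: "(\<Sum>m\<in>Poly_Mapping.keys p. ?s p m) = p" for p :: mpol
    by (rule poly_mapping_sum_singles[symmetric])
  have "ev g ((\<Sum>m\<in>Poly_Mapping.keys p. ?s p m) * (\<Sum>n\<in>Poly_Mapping.keys q. ?s q n))
      = (\<Sum>m\<in>Poly_Mapping.keys p. \<Sum>n\<in>Poly_Mapping.keys q. ev g (?s p m) * ev g (?s q n))"
    unfolding sum_product ev_sum
    by (simp add: ev_single mult_single mon_add const_mult mult_ac)
  also have "\<dots> = ev g (\<Sum>m\<in>Poly_Mapping.keys p. ?s p m) * ev g (\<Sum>n\<in>Poly_Mapping.keys q. ?s q n)"
    unfolding ev_sum sum_product ..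
  finally show ?thesis
    unfolding e .
qed

lemma ev_cpol [simp]: "ev g (cpol c) = const c"
  by (simp add: cpol_def ev_single)

lemma ev_xpol [simp]: "ev g (xpol x) = g x"
  by (simp add: xpol_def ev_single mon_def)

lemma ev_1 [simp]: "ev g 1 = 1"
  using ev_cpol[of g 1] by (simp add: cpol_def)

lemma ev_extends:
  assumes inj: "\<And>p. ev g p = 0 \<Longrightarrow> p = 0"
  shows "\<exists>\<phi>. C_hom \<phi> \<and> (\<forall>x. \<phi> (gen x) = g x)"
proof -
  define \<phi> where "\<phi> x = (let (a, b) = (SOME (a, b). b \<noteq> 0 \<and> x = to_fract a / to_fract b)
    in ev g a / ev g b)" for x
  have \<phi>: "\<phi> (to_fract a / to_fract b) = ev g a / ev g b" if "b \<noteq> 0" for a b :: mpol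
  proof -
    define ab where "ab = (SOME (a', b'). b' \<noteq> 0 \<and> to_fract a / to_fract b = to_fract a' / to_fract b')"
    obtain a' b' where ab': "ab = (a', b')" by fastforce
    have "case ab of (a', b') \<Rightarrow> b' \<noteq> 0 \<and> to_fract a / to_fract b = to_fract a' / to_fract b'"
      unfolding ab_def by (rule someI[of _ "(a, b)"]) (use that in auto)
    then have *: "b' \<noteq> 0" "to_fract a / to_fract b = to_fract a' / to_fract b'" by (simp_all add: ab')
    then have "to_fract (a * b') = to_fract (a' * b)"
      using that by (simp add: field_simps)
    then have "a * b' = a' * b" by (simp only: to_fract_eq_iff)
    then have "ev g a * ev g b' = ev g a' * ev g b" by (metis ev_mult)
    moreover have "ev g b \<noteq> 0" "ev g b' \<noteq> 0" using inj that * by auto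
    ultimately have "ev g a' / ev g b' = ev g a / ev g b" by (simp add: field_simps)
    moreover have "\<phi> (to_fract a / to_fract b) = ev g a' / ev g b'"
      using ab' by (simp add: \<phi>_def ab_def[symmetric])
    ultimately show ?thesis by simp
  qed
  have p: "\<phi> (to_fract a) = ev g a" for a using \<phi>[of 1 a] by simp
  have "field_hom \<phi>"
  proof
    fix x y :: ratfun
    obtain a b where x: "b \<noteq> 0" "x = to_fract a / to_fract b" by (rule ratfun_cases[of x])
    obtain c d where y: "d \<noteq> 0" "y = to_fract c / to_fract d" by (rule ratfun_cases[of y])
    have nz: "ev g b \<noteq> 0" "ev g d \<noteq> 0" using inj x y by auto
    have "x + y = to_fract (a * d + c * b) / to_fract (b * d)"
      using x y by (simp add: field_simps)
    then have "\<phi> (x + y) = ev g (a * d + c * b) / ev g (b * d)"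
      using \<phi>[of "b * d" "a * d + c * b"] x y by simp
    also have "\<dots> = \<phi> x + \<phi> y" using nz
      unfolding x(2) y(2) \<phi>[OF x(1)] \<phi>[OF y(1)] ev_add ev_mult by (simp add: field_simps)
    finally show "\<phi> (x + y) = \<phi> x + \<phi> y" .
    have "x * y = to_fract (a * c) / to_fract (b * d)"
      using x y by (simp add: field_simps)
    then have "\<phi> (x * y) = ev g (a * c) / ev g (b * d)"
      using \<phi>[of "b * d" "a * c"] x y by simp
    also have "\<dots> = \<phi> x * \<phi> y" unfolding x(2) y(2) \<phi>[OF x(1)] \<phi>[OF y(1)] ev_mult by simp
    finally show "\<phi> (x * y) = \<phi> x * \<phi> y" .
  next
    show "\<phi> 0 = 0" using p[of 0] by simp
    show "\<phi> 1 = 1" using p[of 1] by simp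
  qed
  then have "C_hom \<phi>" using p by (simp add: C_hom_def const_def)
  moreover have "\<phi> (gen x) = g x" for x using p by (simp add: gen_def)
  ultimately show ?thesis by blast
qed

lemma xpol_nonzero [simp]: "xpol x \<noteq> 0"
  unfolding xpol_def by (metis lookup_single_eq lookup_zero zero_neq_one)

lemma gen_nonzero [simp]: "gen x \<noteq> 0"
  by (simp add: gen_def)


section \<open>The reflections on rational functions\<close>

fun reflection_image :: "int \<Rightarrow> indet \<Rightarrow> ratfun" where
  "reflection_image i (Alpha j) =
    (if j = i then - \<alpha> i else if j = i + 1 \<or> j = i - 1 then \<alpha> j + \<alpha> i else \<alpha> j)"
| "reflection_image i (F j) =
    (if j = i + 1 then \<ff> j + \<alpha> i / \<ff> i else if j = i - 1 then \<ff> j - \<alpha> i / \<ff> i else \<ff> j)"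
| "reflection_image i (Tau j) = (if j = i then \<ff> i * \<tau> (i - 1) * \<tau> (i + 1) / \<tau> i else \<tau> j)"

definition reflection :: "int \<Rightarrow> ratfun \<Rightarrow> ratfun" where
  "reflection i = (THE \<phi>. C_automorphism \<phi> \<and> (\<forall>x. \<phi> (gen x) = reflection_image i x))"

lemma ex3I: "P a b c \<Longrightarrow> \<exists>a b c. P a b c"
  by blast

lemma reflection_image_inj:
  assumes "ev (reflection_image i) p = 0"
  shows "p = 0"
proof -
  let ?h = "ev (reflection_image i)"
  let ?d = "\<lambda>a b. xpol (F i) ^ a * xpol (Tau i) ^ b"
  have pow: "?h (p ^ n) = ?h p ^ n" for p n
    by (induction n) (simp_all add: ev_mult)
  have neg: "?h (- p) = - ?h p" for p
    using ev_add[of "reflection_image i" p "- p"] by (simp add: minus_unique)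
  have diff: "?h (p - q) = ?h p - ?h q" for p q
    using ev_add[of "reflection_image i" "p - q" q] by simp
  have "\<exists>a b q. to_fract (?d a b) * ?h p = to_fract q \<and> ?h q = ?h (?d a b) * to_fract p"
  proof (induction p rule: mpol_induct)
    case (const c)
    show ?case
      by (rule exI[of _ 0], rule exI[of _ 0], rule exI[of _ "cpol c"]) (simp add: const_def)
  next
    case (gen x)
    show ?case
    proof (cases x)
      case (Alpha j)
      consider "j = i" | "j = i + 1 \<or> j = i - 1" | "j \<noteq> i" "j \<noteq> i + 1" "j \<noteq> i - 1" by blast
      then show ?thesis
      proof cases
        case 1
        then show ?thesis using Alpha
          by (intro ex3I[of _ 0 0 "- xpol (Alpha i)"]) (simp add: neg gen_def)
      next
        case 2
        then show ?thesis using Alpha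
          by (intro ex3I[of _ 0 0 "xpol (Alpha j) + xpol (Alpha i)"]) (auto simp: ev_add gen_def)
      next
        case 3
        then show ?thesis using Alpha
          by (intro ex3I[of _ 0 0 "xpol (Alpha j)"]) (simp add: gen_def)
      qed
    next
      case (F j)
      consider "j = i + 1" | "j = i - 1" | "j \<noteq> i + 1" "j \<noteq> i - 1" by blast
      then show ?thesis
      proof cases
        case 1
        then show ?thesis using F
          by (intro ex3I[of _ 1 0 "xpol (F i) * xpol (F j) + xpol (Alpha i)"])
            (simp add: ev_add ev_mult gen_def field_simps)
      next
        case 2
        then show ?thesis using F
          by (intro ex3I[of _ 1 0 "xpol (F i) * xpol (F j) - xpol (Alpha i)"])
            (simp add: diff ev_mult gen_def field_simps)
      next
        case 3
        then show ?thesis using F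
          by (intro ex3I[of _ 0 0 "xpol (F j)"]) (simp add: gen_def)
      qed
    next
      case (Tau j)
      show ?thesis
      proof (cases "j = i")
        case True
        then show ?thesis using Tau
          by (intro ex3I[of _ 0 1 "xpol (F i) * xpol (Tau (i - 1)) * xpol (Tau (i + 1))"])
            (simp add: ev_mult gen_def field_simps)
      next
        case False
        then show ?thesis using Tau
          by (intro ex3I[of _ 0 0 "xpol (Tau j)"]) (simp add: gen_def)
      qed
    qed
  next
    case (add p q)
    then obtain a b p' c d q' where 1: "to_fract (?d a b) * ?h p = to_fract p'" "?h p' = ?h (?d a b) * to_fract p"
      and 2: "to_fract (?d c d) * ?h q = to_fract q'" "?h q' = ?h (?d c d) * to_fract q" by blast
    have d: "?d (a + c) (b + d) = ?d a b * ?d c d" by (simp add: power_add mult_ac)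
    have "to_fract (?d (a + c) (b + d)) * ?h (p + q) = to_fract (?d c d * p' + ?d a b * q')"
      unfolding d to_fract_mult to_fract_add ev_add 1(1)[symmetric] 2(1)[symmetric]
      by (simp add: algebra_simps)
    moreover have "?h (?d c d * p' + ?d a b * q') = ?h (?d (a + c) (b + d)) * to_fract (p + q)"
      unfolding d ev_mult[of _ "?d a b"] ev_mult[of _ "?d c d"] to_fract_mult to_fract_add ev_add 1(2) 2(2)
      by (simp add: algebra_simps)
    ultimately show ?case by blast
  next
    case (mult p q)
    then obtain a b p' c d q' where 1: "to_fract (?d a b) * ?h p = to_fract p'" "?h p' = ?h (?d a b) * to_fract p"
      and 2: "to_fract (?d c d) * ?h q = to_fract q'" "?h q' = ?h (?d c d) * to_fract q" by blast
    have d: "?d (a + c) (b + d) = ?d a b * ?d c d" by (simp add: power_add mult_ac)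
    have "to_fract (?d (a + c) (b + d)) * ?h (p * q) = to_fract (p' * q')"
      unfolding d to_fract_mult ev_mult 1(1)[symmetric] 2(1)[symmetric]
      by (simp add: algebra_simps)
    moreover have "?h (p' * q') = ?h (?d (a + c) (b + d)) * to_fract (p * q)"
      unfolding d ev_mult[of _ p' q'] ev_mult[of _ "?d a b" "?d c d"] to_fract_mult 1(2) 2(2)
      by (simp add: algebra_simps)
    ultimately show ?case by blast
  qed
  then obtain a b q where q: "to_fract (?d a b) * ?h p = to_fract q" "?h q = ?h (?d a b) * to_fract p"
    by blast
  from q(1) assms have "q = 0" by simp
  with q(2) have "?h (?d a b) * to_fract p = 0" by simp
  moreover have "?h (?d a b) \<noteq> 0" by (simp add: ev_mult pow)
  ultimately show ?thesis by simp
qed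

lemma C_hom_id: "C_hom id"
proof -
  have "field_hom (id :: ratfun \<Rightarrow> ratfun)"
    by standard simp_all
  then show ?thesis by (simp add: C_hom_def)
qed

lemma C_hom_comp:
  assumes "C_hom \<phi>" "C_hom \<psi>" shows "C_hom (\<phi> \<circ> \<psi>)"
proof -
  interpret h: field_hom \<phi> using assms by (simp add: C_hom_def)
  interpret k: field_hom \<psi> using assms by (simp add: C_hom_def)
  have "field_hom (\<phi> \<circ> \<psi>)"
    by standard (simp_all add: h.hom_add k.hom_add h.hom_mult k.hom_mult)
  with assms show ?thesis by (simp add: C_hom_def)
qed

lemma reflection_ex1: "\<exists>!\<phi>. C_automorphism \<phi> \<and> (\<forall>x. \<phi> (gen x) = reflection_image i x)"
proof -
  obtain \<phi> where \<phi>: "C_hom \<phi>" "\<And>x. \<phi> (gen x) = reflection_image i x"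
    using ev_extends[OF reflection_image_inj[of i]] by blast
  interpret h: field_hom \<phi> using \<phi> by (simp add: C_hom_def)
  have "\<phi> \<circ> \<phi> = id"
  proof (rule C_hom_unique)
    fix x show "(\<phi> \<circ> \<phi>) (gen x) = id (gen x)"
      by (cases x) (auto simp: \<phi>(2) h.hom_add h.hom_minus h.hom_mult h.hom_div h.hom_uminus field_simps)
  qed (use \<phi> C_hom_id C_hom_comp in auto)
  then have "bij \<phi>" by (rule o_bij) fact
  with \<phi> show ?thesis unfolding C_automorphism_def by (metis C_hom_unique)
qed

lemma reflection_automorphism: "C_automorphism (reflection i)"
  and reflection_gen: "reflection i (gen x) = reflection_image i x"
  using theI'[OF reflection_ex1[of i]] by (simp_all flip: reflection_def)

lemma C_hom_reflection: "C_hom (reflection i)"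
  using reflection_automorphism by (simp add: C_automorphism_def)

lemmas reflection_hom = C_hom_reflection[unfolded C_hom_def, THEN conjunct1]
interpretation reflection: field_hom "reflection i" for i
  by (rule reflection_hom)

lemmas reflection_distribs =
  reflection.hom_add reflection.hom_minus reflection.hom_uminus reflection.hom_mult reflection.hom_div

lemma reflection_square: "reflection i \<circ> reflection i = id"
proof (rule C_hom_unique)
  fix x show "(reflection i \<circ> reflection i) (gen x) = id (gen x)"
    by (cases x) (auto simp: reflection_gen reflection_distribs)
qed (auto intro: C_hom_id C_hom_comp C_hom_reflection)

lemma reflection_commute:
  assumes "j \<noteq> i + 1" "j \<noteq> i - 1"
  shows "reflection i \<circ> reflection j = reflection j \<circ> reflection i"
proof (rule C_hom_unique)
  fix x show "(reflection i \<circ> reflection j) (gen x) = (reflection j \<circ> reflection i) (gen x)"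
    using assms by (cases x) (auto simp: reflection_gen reflection_distribs add.commute)
qed (auto intro: C_hom_comp C_hom_reflection)

context
  fixes a b p q :: "'a :: field"
  assumes nz: "p \<noteq> 0" "q \<noteq> 0" "p * q + a \<noteq> 0" "p * q - b \<noteq> 0"
begin

lemma braid_denominators:
  "q + a / p = (p * q + a) / p" "p - b / q = (p * q - b) / q"
  "q + (a + b) / (p - b / q) = q * (p * q + a) / (p * q - b)"
  "p - (a + b) / (q + a / p) = p * (p * q - b) / (p * q + a)"
proof -
  show 1: "q + a / p = (p * q + a) / p" and 2: "p - b / q = (p * q - b) / q"
    using nz by (simp_all add: field_simps)
  have "q * (p * q - b) + (a + b) * q = q * (p * q + a)" by (simp add: algebra_simps)
  then show "q + (a + b) / (p - b / q) = q * (p * q + a) / (p * q - b)"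
    unfolding 2 using nz(2,4) by (simp add: add_divide_eq_iff)
  have "p * (p * q + a) - (a + b) * p = p * (p * q - b)" by (simp add: algebra_simps)
  then show "p - (a + b) / (q + a / p) = p * (p * q - b) / (p * q + a)"
    unfolding 1 using nz(1,3) by (simp add: diff_divide_eq_iff)
qed

lemma braid_identity_1: "p - (a + b) / (q + a / p) = p - b / q - a / (q + (a + b) / (p - b / q))"
proof -
  have "p * (p * q - b) / (p * q + a) = (p * q - b) / q - a * (p * q - b) / (q * (p * q + a))"
    using nz by (simp add: divide_simps) (simp add: algebra_simps)
  then show ?thesis
    unfolding braid_denominators(3,4) unfolding braid_denominators(1,2) by simp
qed

lemma braid_identity_2: "q + a / p + b / (p - (a + b) / (q + a / p)) = q + (a + b) / (p - b / q)"
proof -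
  have "(p * q + a) / p + b * (p * q + a) / (p * (p * q - b)) = q * (p * q + a) / (p * q - b)"
    using nz by (simp add: divide_simps) (simp add: algebra_simps)
  then show ?thesis
    unfolding braid_denominators(3,4) unfolding braid_denominators(1,2) by simp
qed

lemma braid_identity_4: "(q + a / p) * p = (q + (a + b) / (p - b / q)) * (p - b / q)"
  unfolding braid_denominators(3,4) unfolding braid_denominators(1,2) using nz by simp

lemma braid_identity_3: "(p - (a + b) / (q + a / p)) * (q + a / p) = (p - b / q) * q"
  unfolding braid_denominators(3,4) unfolding braid_denominators(1,2) using nz by simp

end

lemma reflection_braid:
  "reflection i \<circ> reflection (i + 1) \<circ> reflection i
    = reflection (i + 1) \<circ> reflection i \<circ> reflection (i + 1)"
proof (rule C_hom_unique)
  have "reflection i (\<ff> (i + 1)) \<noteq> 0" "reflection (i + 1) (\<ff> i) \<noteq> 0" by simp_all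
  then have nz: "\<ff> i * \<ff> (i + 1) + \<alpha> i \<noteq> 0" "\<ff> i * \<ff> (i + 1) - \<alpha> (i + 1) \<noteq> 0"
    by (simp_all add: reflection_gen field_simps)
  note id1 = braid_identity_1[OF gen_nonzero gen_nonzero nz]
    and id2 = braid_identity_2[OF gen_nonzero gen_nonzero nz]
    and id4 = braid_identity_4[OF gen_nonzero gen_nonzero nz]
    and id3 = braid_identity_3[OF gen_nonzero gen_nonzero nz]
  fix x show "(reflection i \<circ> reflection (i + 1) \<circ> reflection i) (gen x)
    = (reflection (i + 1) \<circ> reflection i \<circ> reflection (i + 1)) (gen x)"
  proof (cases x)
    case (Alpha j)
    consider "j = i - 1" | "j = i" | "j = i + 1" | "j = i + 2" | "j \<notin> {i - 1, i, i + 1, i + 2}" by blast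
    then show ?thesis
      by cases (simp_all add: Alpha reflection_gen reflection_distribs)
  next
    case (F j)
    consider "j = i - 1" | "j = i" | "j = i + 1" | "j = i + 2" | "j \<notin> {i - 1, i, i + 1, i + 2}" by blast
    then show ?thesis
    proof cases
      case 1
      then show ?thesis using id2
        by (simp add: F reflection_gen reflection_distribs algebra_simps)
    next
      case 2
      then show ?thesis using id1
        by (simp add: F reflection_gen reflection_distribs algebra_simps)
    next
      case 3
      then show ?thesis using id2
        by (simp add: F reflection_gen reflection_distribs algebra_simps)
    next
      case 4
      then show ?thesis using id1
        by (simp add: F reflection_gen reflection_distribs algebra_simps)
    next
      case 5
      then show ?thesis by (simp add: F reflection_gen reflection_distribs)
    qed
  next
    case (Tau j)
    consider "j = i" | "j = i + 1" | "j \<notin> {i, i + 1}" by blast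
    then show ?thesis
    proof cases
      case 1
      then show ?thesis using id3
        by (simp add: Tau reflection_gen reflection_distribs) (simp add: field_simps)
    next
      case 2
      then show ?thesis using id4
        by (simp add: Tau reflection_gen reflection_distribs)
    next
      case 3
      then show ?thesis by (simp add: Tau reflection_gen reflection_distribs)
    qed
  qed
qed (auto intro: C_hom_comp C_hom_reflection)


section \<open>The Weyl group\<close>

text \<open>Words modulo the Coxeter relations. Since \<open>s\<^sub>i\<^sup>2 = 1\<close> is among the relations, the monoid they
  present is already the Coxeter group.\<close>

inductive coxeter_eq :: "int list \<Rightarrow> int list \<Rightarrow> bool" where
  coxeter_refl: "coxeter_eq u u"
| coxeter_sym: "coxeter_eq u v \<Longrightarrow> coxeter_eq v u"
| coxeter_trans: "coxeter_eq u v \<Longrightarrow> coxeter_eq v w \<Longrightarrow> coxeter_eq u w"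
| coxeter_square: "coxeter_eq (u @ [i, i] @ v) (u @ v)"
| coxeter_braid: "coxeter_eq (u @ [i, i + 1, i, i + 1, i, i + 1] @ v) (u @ v)"
| coxeter_commute: "j \<noteq> i + 1 \<Longrightarrow> j \<noteq> i - 1 \<Longrightarrow> coxeter_eq (u @ [i, j] @ v) (u @ [j, i] @ v)"

quotient_type weyl = "int list" / coxeter_eq
  by (rule equivpI)
    (auto simp: reflp_def symp_def transp_def intro: coxeter_refl coxeter_sym coxeter_trans)

lemma coxeter_eq_append_left: "coxeter_eq u v \<Longrightarrow> coxeter_eq (w @ u) (w @ v)"
proof (induction rule: coxeter_eq.induct)
  case (coxeter_square u i v)
  show ?case using coxeter_eq.coxeter_square[of "w @ u" i v] by simp
next
  case (coxeter_braid u i v)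
  show ?case using coxeter_eq.coxeter_braid[of "w @ u" i v] by simp
next
  case (coxeter_commute j i u v)
  show ?case using coxeter_eq.coxeter_commute[OF coxeter_commute, of "w @ u" v] by simp
qed (blast intro: coxeter_refl coxeter_sym coxeter_trans)+

lemma coxeter_eq_append_right: "coxeter_eq u v \<Longrightarrow> coxeter_eq (u @ w) (v @ w)"
proof (induction rule: coxeter_eq.induct)
  case (coxeter_square u i v)
  show ?case using coxeter_eq.coxeter_square[of u i "v @ w"] by simp
next
  case (coxeter_braid u i v)
  show ?case using coxeter_eq.coxeter_braid[of u i "v @ w"] by simp
next
  case (coxeter_commute j i u v)
  show ?case using coxeter_eq.coxeter_commute[OF coxeter_commute, of u "v @ w"] by simp
qed (blast intro: coxeter_refl coxeter_sym coxeter_trans)+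

instantiation weyl :: monoid_mult
begin

lift_definition one_weyl :: weyl is "[]" .

lift_definition times_weyl :: "weyl \<Rightarrow> weyl \<Rightarrow> weyl" is "(@)"
  by (blast intro: coxeter_trans coxeter_eq_append_left coxeter_eq_append_right)

instance
  by standard (transfer, simp add: coxeter_refl)+

end

lift_definition sgen :: "int \<Rightarrow> weyl" is "\<lambda>i. [i]" .

lemma sgen_square: "sgen i * sgen i = 1"
  using coxeter_square[of "[]" i "[]"]
  by (simp add: sgen.abs_eq times_weyl.abs_eq one_weyl.abs_eq weyl.abs_eq_iff)

lemma sgen_braid: "(sgen i * sgen (i + 1)) ^ 3 = 1"
  using coxeter_braid[of "[]" i "[]"]
  by (simp add: power3_eq_cube sgen.abs_eq times_weyl.abs_eq one_weyl.abs_eq weyl.abs_eq_iff)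

lemma sgen_commute: "j \<noteq> i + 1 \<Longrightarrow> j \<noteq> i - 1 \<Longrightarrow> sgen i * sgen j = sgen j * sgen i"
  using coxeter_commute[of j i "[]" "[]"]
  by (simp add: sgen.abs_eq times_weyl.abs_eq weyl.abs_eq_iff)

lemma weyl_induct [case_names one sgen]:
  assumes "P 1" "\<And>i w. P w \<Longrightarrow> P (sgen i * w)"
  shows "P w"
proof -
  have "P (abs_weyl u)" for u
  proof (induction u)
    case Nil
    show ?case using assms(1) by (simp add: one_weyl_def)
  next
    case (Cons i u)
    have "sgen i * abs_weyl u = abs_weyl (i # u)"
      by (simp add: sgen.abs_eq times_weyl.abs_eq)
    then show ?case using assms(2)[OF Cons, of i] by simp
  qed
  then show ?thesis by (metis Quotient_weyl Quotient_abs_rep)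
qed

lemma weyl_inverse: "\<exists>v. v * w = 1 \<and> w * v = (1 :: weyl)"
proof (induction w rule: weyl_induct)
  case one
  show ?case by (rule exI[of _ 1]) simp
next
  case (sgen i w)
  then obtain v where v: "v * w = 1" "w * v = 1" by blast
  have "(v * sgen i) * (sgen i * w) = v * (sgen i * sgen i) * w"
    by (simp only: mult.assoc)
  moreover have "(sgen i * w) * (v * sgen i) = sgen i * (w * v) * sgen i"
    by (simp only: mult.assoc)
  ultimately show ?case
    using v by (intro exI[of _ "v * sgen i"]) (simp add: sgen_square)
qed

lemma foldr_coxeter_eq:
  assumes "\<And>i. h i \<circ> h i = id"
    and "\<And>i. h i \<circ> h (i + 1) \<circ> h i = h (i + 1) \<circ> h i \<circ> h (i + 1)"
    and "\<And>i j. j \<noteq> i + 1 \<Longrightarrow> j \<noteq> i - 1 \<Longrightarrow> h i \<circ> h j = h j \<circ> h i"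
    and "coxeter_eq u v"
  shows "foldr h u = foldr h v"
  using assms(4)
proof (induction rule: coxeter_eq.induct)
  case (coxeter_square u i v)
  show ?case using assms(1)[of i] by (simp add: fun_eq_iff)
next
  case (coxeter_braid u i v)
  have "h i (h (i + 1) (h i (h (i + 1) (h i (h (i + 1) x))))) = x" for x
    using assms(1)[of i] assms(1)[of "i + 1"] assms(2)[of i] by (simp add: fun_eq_iff)
  then show ?case by (simp add: fun_eq_iff)
next
  case (coxeter_commute j i u v)
  then show ?case using assms(3)[of j i] by (simp add: fun_eq_iff)
qed simp_all

lift_definition act :: "weyl \<Rightarrow> ratfun \<Rightarrow> ratfun" is "foldr reflection"
  by (rule foldr_coxeter_eq) (rule reflection_square reflection_braid reflection_commute | assumption)+

lemma act_one [simp]: "act 1 x = x"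
  by transfer simp

lemma act_mult: "act (v * w) x = act v (act w x)"
  by transfer simp

lemma act_sgen: "act (sgen i) x = reflection i x"
  by transfer simp


section \<open>Weights and Maya diagrams\<close>

text \<open>The free abelian group on the fundamental weights \<open>\<Lambda>\<^sub>i\<close>.\<close>

type_synonym weight = "int \<Rightarrow>\<^sub>0 int"

abbreviation \<Lambda> :: "int \<Rightarrow> weight" where
  "\<Lambda> i \<equiv> frag_of i"

definition weight_reflection :: "int \<Rightarrow> weight \<Rightarrow> weight" where
  "weight_reflection i = frag_extend (\<lambda>j. if j = i then \<Lambda> (i + 1) + \<Lambda> (i - 1) - \<Lambda> i else \<Lambda> j)"

lemma weight_reflection_eq:
  "weight_reflection i x =
    x + frag_cmul (Poly_Mapping.lookup x i) (\<Lambda> (i + 1) + \<Lambda> (i - 1) - frag_cmul 2 (\<Lambda> i))"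
proof (induction x rule: frag_induction[OF subset_UNIV])
  case 1
  show ?case by (simp add: weight_reflection_def)
next
  case (2 x)
  show ?case
    by (rule poly_mapping_eqI) (auto simp: weight_reflection_def lookup_add lookup_minus)
next
  case (3 a b)
  then show ?case
    by (simp add: weight_reflection_def frag_extend_diff lookup_minus frag_cmul_diff_distrib)
qed

lemma lookup_weight_reflection:
  "Poly_Mapping.lookup (weight_reflection i x) k =
    (if k = i then - Poly_Mapping.lookup x i
     else if k = i + 1 \<or> k = i - 1 then Poly_Mapping.lookup x k + Poly_Mapping.lookup x i
     else Poly_Mapping.lookup x k)"
  by (auto simp: weight_reflection_eq lookup_add lookup_minus)

lift_definition weight_act :: "weyl \<Rightarrow> weight \<Rightarrow> weight" is "foldr weight_reflection"
proof (rule foldr_coxeter_eq)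
  fix i j :: int
  show "weight_reflection i \<circ> weight_reflection i = id"
    by (intro ext poly_mapping_eqI) (simp add: lookup_weight_reflection)
  show "weight_reflection i \<circ> weight_reflection (i + 1) \<circ> weight_reflection i
      = weight_reflection (i + 1) \<circ> weight_reflection i \<circ> weight_reflection (i + 1)"
  proof (intro ext poly_mapping_eqI)
    fix x k
    consider "k = i - 1" | "k = i" | "k = i + 1" | "k = i + 2" | "k \<notin> {i - 1, i, i + 1, i + 2}" by blast
    then show "Poly_Mapping.lookup ((weight_reflection i \<circ> weight_reflection (i + 1) \<circ> weight_reflection i) x) k
      = Poly_Mapping.lookup ((weight_reflection (i + 1) \<circ> weight_reflection i \<circ> weight_reflection (i + 1)) x) k"
      by cases (simp_all add: lookup_weight_reflection)
  qed
  show "weight_reflection i \<circ> weight_reflection j = weight_reflection j \<circ> weight_reflection i"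
    if "j \<noteq> i + 1" "j \<noteq> i - 1"
    using that by (intro ext poly_mapping_eqI) (auto simp: lookup_weight_reflection)
qed

definition v_wt :: "int \<Rightarrow> weight" where
  "v_wt i = \<Lambda> i - \<Lambda> (i - 1)"

definition perm_of :: "weyl \<Rightarrow> int \<Rightarrow> int" where
  "perm_of w j = (THE k. weight_act w (v_wt j) = v_wt k)"

lemma v_wt_inj: "v_wt j = v_wt k \<longleftrightarrow> j = k"
proof
  assume "v_wt j = v_wt k"
  then have "Poly_Mapping.lookup (v_wt j) i = Poly_Mapping.lookup (v_wt k) i" for i by simp
  from this[of j] this[of k] show "j = k"
    by (auto simp: v_wt_def lookup_minus split: if_splits)
qed simp

lemma weight_reflection_v_wt:
  "weight_reflection i (v_wt j) = v_wt (if j = i then i + 1 else if j = i + 1 then i else j)"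
  by (intro poly_mapping_eqI) (auto simp: lookup_weight_reflection v_wt_def lookup_minus)

lemma weight_act_v_wt: "weight_act w (v_wt j) = v_wt (perm_of w j)"
proof -
  have "\<exists>k. weight_act w (v_wt j) = v_wt k"
  proof (induction w rule: weyl_induct)
    case one
    have "weight_act 1 (v_wt j) = v_wt j" by transfer simp
    then show ?case by blast
  next
    case (sgen i w)
    have "weight_act (sgen i * w) x = weight_reflection i (weight_act w x)" for x
      by transfer simp
    with sgen show ?case using weight_reflection_v_wt by metis
  qed
  then show ?thesis unfolding perm_of_def by (metis (mono_tags, lifting) theI v_wt_inj)
qed

definition maya :: "weyl \<Rightarrow> int set" where
  "maya w = perm_of w ` {..0}"


section \<open>Partitions\<close>

text \<open>Partitions are lists of positive parts; \<open>part\<close>, \<open>conj_part\<close> and the Young diagram use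
  indices starting at 1, as does the Frobenius symbol
  \<open>(frob_arm \<mu> 1 > \<dots> > frob_arm \<mu> k, frob_leg \<mu> 1 > \<dots> > frob_leg \<mu> k)\<close> with \<open>k = durfee \<mu>\<close>.\<close>

definition is_partition :: "nat list \<Rightarrow> bool" where
  "is_partition \<mu> \<longleftrightarrow> sorted_wrt (\<ge>) \<mu> \<and> (\<forall>x\<in>set \<mu>. 0 < x)"

definition part :: "nat list \<Rightarrow> nat \<Rightarrow> nat" where
  "part \<mu> i = (if i \<in> {1..length \<mu>} then \<mu> ! (i - 1) else 0)"

definition young :: "nat list \<Rightarrow> (nat \<times> nat) set" where
  "young \<mu> = {(i, j). 1 \<le> i \<and> i \<le> length \<mu> \<and> 1 \<le> j \<and> j \<le> part \<mu> i}"

definition conj_part :: "nat list \<Rightarrow> nat \<Rightarrow> nat" where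
  "conj_part \<mu> j = card {i. (i, j) \<in> young \<mu>}"

definition durfee :: "nat list \<Rightarrow> nat" where
  "durfee \<mu> = Max (insert 0 {n \<in> {1..length \<mu>}. n \<le> part \<mu> n})"

definition frob_arm :: "nat list \<Rightarrow> nat \<Rightarrow> int" where
  "frob_arm \<mu> n = int (part \<mu> n) - int n + 1"

definition frob_leg :: "nat list \<Rightarrow> nat \<Rightarrow> int" where
  "frob_leg \<mu> n = int (conj_part \<mu> n) - int n"

definition partition_of :: "weyl \<Rightarrow> nat list" where
  "partition_of w = (THE \<mu>. is_partition \<mu> \<and>
     frob_arm \<mu> ` {1..durfee \<mu>} = maya w \<inter> {0<..} \<and>
     (\<lambda>n. - frob_leg \<mu> n) ` {1..durfee \<mu>} = {..0} - maya w)"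


section \<open>The functions \<open>\<phi>\<^sub>w(\<Lambda>\<^sub>0)\<close> and their normalizations\<close>

definition phi :: "weyl \<Rightarrow> ratfun" where
  "phi w = act w (\<tau> 0) /
     (\<Prod>i\<in>Poly_Mapping.keys (weight_act w (\<Lambda> 0)). \<tau> i powi Poly_Mapping.lookup (weight_act w (\<Lambda> 0)) i)"

text \<open>\<open>v\<^sub>a - v\<^sub>b\<close> read in the field through \<open>\<alpha>\<^sub>i = v\<^sub>i - v\<^sub>i\<^sub>+\<^sub>1\<close>.\<close>

definition v_diff :: "int \<Rightarrow> int \<Rightarrow> ratfun" where
  "v_diff a b = (if a \<le> b then (\<Sum>i\<in>{a..<b}. \<alpha> i) else - (\<Sum>i\<in>{b..<a}. \<alpha> i))"

definition hook_factor :: "nat list \<Rightarrow> ratfun" where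
  "hook_factor \<mu> = (\<Prod>(i, j)\<in>young \<mu>. v_diff (int j - int (conj_part \<mu> j)) (int (part \<mu> i) - int i + 1))"

definition phi_tilde :: "weyl \<Rightarrow> ratfun" where
  "phi_tilde w = phi w / hook_factor (partition_of w)"

text \<open>\<open>(s\<^sub>-\<^sub>q \<cdots> s\<^sub>-\<^sub>2 s\<^sub>-\<^sub>1) (s\<^sub>p\<^sub>-\<^sub>1 \<cdots> s\<^sub>1 s\<^sub>0)\<close>\<close>

definition hook :: "int \<Rightarrow> int \<Rightarrow> weyl" where
  "hook p q = prod_list (map sgen [- q..-1]) * prod_list (map sgen (rev [0..p - 1]))"

end

theory Submission
  imports Defs
begin

text \<open>Write \<open>[a, b] = v\<^sub>a - v\<^sub>b\<close>. For a hook with Maya diagram \<open>\<int>\<^sub>\<le>\<^sub>0 - {y} \<union> {p}\<close> let \<open>h(p, y)\<close> be the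
  corresponding translate of \<open>\<tau>\<^sub>0\<close> divided by \<open>\<tau>\<^sub>0\<close>. The formula is equivalent to
  \<open>w(\<tau>\<^sub>0) \<cdot> det (1 / [y, p]) = \<tau>\<^sub>0 \<cdot> det (h(p, y) / [y, p])\<close>, where \<open>p\<close> runs over the positive elements of the
  Maya diagram of \<open>w\<close> and \<open>y\<close> over the missing nonpositive ones, and this is shown by induction on
  \<open>w\<close>. The reflections \<open>s\<^sub>i\<close> with \<open>i \<noteq> 0\<close> only permute the labels \<open>p\<close> and \<open>y\<close>. Under \<open>s\<^sub>0\<close> both matrices undergo the same
  rescaling of rows and columns combined with the principal pivot transform at the entry \<open>(1, 0)\<close>:
  for the Cauchy matrix this is the exchange identity for differences, and for the hook matrix it is
  a three-term relation which has to be computed only for \<open>(p, y) = (2, -1)\<close>. Finally Cauchy's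
  determinant and the product over the cells of the Young diagram, read as pairs (hole, bead), agree
  up to factors depending on \<open>p\<close> or \<open>y\<close> alone.\<close>

section \<open>Determinants indexed by lists\<close>

text \<open>Rows and columns are indexed by lists of labels, so that a reflection can act on the
  labels themselves. The size is read off the row list, hence the hypotheses on lengths
  below.\<close>

definition list_det :: "('i \<Rightarrow> 'j \<Rightarrow> 'a :: comm_ring_1) \<Rightarrow> 'i list \<Rightarrow> 'j list \<Rightarrow> 'a" where
  "list_det G xs ys = det (mat (length xs) (length xs) (\<lambda>(a, b). G (xs ! a) (ys ! b)))"

lemma list_det_Nil [simp]: "list_det G [] ys = 1"
  by (simp add: list_det_def)

lemma list_det_single [simp]: "list_det G [x] [y] = G x y"
  by (simp add: list_det_def det_single)

lemma list_det_cong: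
  assumes "length xs = length ys" "\<And>x y. x \<in> set xs \<Longrightarrow> y \<in> set ys \<Longrightarrow> G x y = G' x y"
  shows "list_det G xs ys = list_det G' xs ys"
  unfolding list_det_def by (rule arg_cong[where f = det], rule cong_mat) (use assms in auto)

lemma list_det_map:
  assumes "length xs = length ys"
  shows "list_det G (map f xs) (map g ys) = list_det (\<lambda>x y. G (f x) (g y)) xs ys"
  unfolding list_det_def by (simp, rule arg_cong[where f = det], rule cong_mat) (use assms in auto)

lemma (in field_hom) hom_list_det: "hom (list_det G xs ys) = list_det (\<lambda>x y. hom (G x y)) xs ys"
proof -
  let ?A = "mat (length xs) (length xs) (\<lambda>(a, b). G (xs ! a) (ys ! b))"
  have "map_mat hom ?A = mat (length xs) (length xs) (\<lambda>(a, b). hom (G (xs ! a) (ys ! b)))"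
    by (intro eq_matI) auto
  then show ?thesis unfolding list_det_def hom_det[symmetric] by simp
qed

lemma list_det_transpose:
  assumes "length xs = length ys"
  shows "list_det (\<lambda>y x. G x y) ys xs = list_det G xs ys"
proof -
  let ?A = "mat (length xs) (length xs) (\<lambda>(a, b). G (xs ! a) (ys ! b))"
  have "det (transpose_mat ?A) = det ?A" by (rule det_transpose[of _ "length xs"]) simp
  moreover have "transpose_mat ?A = mat (length ys) (length ys) (\<lambda>(a, b). G (xs ! b) (ys ! a))"
    using assms by (intro eq_matI) auto
  ultimately show ?thesis by (simp add: list_det_def)
qed

lemma prod_list_map_eq_prod_nth: "prod_list (map f xs) = (\<Prod>i<length xs. f (xs ! i))"
  for f :: "'i \<Rightarrow> 'a :: comm_monoid_mult"
  by (induction xs) (simp_all add: prod.lessThan_Suc_shift del: prod.lessThan_Suc)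

lemma list_det_scale:
  fixes G :: "'i \<Rightarrow> 'j \<Rightarrow> 'a :: comm_ring_1"
  assumes "length xs = length ys"
  shows "list_det (\<lambda>x y. r x * c y * G x y) xs ys
    = prod_list (map r xs) * prod_list (map c ys) * list_det G xs ys"
proof -
  let ?n = "length xs" and ?A = "\<lambda>i j. G (xs ! i) (ys ! j)"
  have 1: "(\<Prod>i = 0..<?n. r (xs ! i) * c (ys ! p i) * ?A i (p i))
      = prod_list (map r xs) * prod_list (map c ys) * (\<Prod>i = 0..<?n. ?A i (p i))"
    if p: "p permutes {0..<?n}" for p
  proof -
    \<comment> \<open>Each Leibniz term meets every column once, so its column factors multiply to
      the same product for every permutation \<open>p\<close>.\<close>
    have "(\<Prod>i = 0..<?n. c (ys ! p i)) = (\<Prod>i = 0..<?n. c (ys ! i))"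
      using prod.permute[OF p, of "\<lambda>i. c (ys ! i)"] by (simp add: o_def)
    then show ?thesis
      by (simp add: prod.distrib prod_list_map_eq_prod_nth assms atLeast0LessThan)
  qed
  have "list_det (\<lambda>x y. r x * c y * G x y) xs ys = (\<Sum>p | p permutes {0..<?n}.
      signof p * (\<Prod>i = 0..<?n. r (xs ! i) * c (ys ! p i) * ?A i (p i)))"
    unfolding list_det_def by (subst det_def'[of _ ?n]) (auto intro!: sum.cong prod.cong)
  also have "\<dots> = (\<Sum>p | p permutes {0..<?n}. prod_list (map r xs) * prod_list (map c ys)
      * (signof p * (\<Prod>i = 0..<?n. ?A i (p i))))"
    by (intro sum.cong refl) (simp only: mem_Collect_eq 1 mult.left_commute)
  also have "\<dots> = prod_list (map r xs) * prod_list (map c ys) * list_det G xs ys"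
    unfolding list_det_def
    by (subst det_def'[of _ ?n]) (auto intro!: sum.cong prod.cong simp: sum_distrib_left)
  finally show ?thesis .
qed

text \<open>The sign of the sorting permutation depends on the two row lists alone. It is therefore
  obtained before \<open>G\<close> and \<open>ys\<close>, so that different matrices with the same
  labels change by the same factor.\<close>

lemma list_det_permute_rows:
  assumes "distinct xs" "distinct xs'" "set xs = set xs'"
  obtains \<epsilon> :: "'a :: idom" where "\<epsilon> * \<epsilon> = 1"
    "\<And>G :: 'i \<Rightarrow> 'j \<Rightarrow> 'a. \<And>ys. length ys = length xs \<Longrightarrow> list_det G xs' ys = \<epsilon> * list_det G xs ys"
proof -
  have "mset xs' = mset xs" using assms by (metis set_eq_iff_mset_eq_distinct)
  then obtain \<pi> where \<pi>: "\<pi> permutes {..<length xs}" "permute_list \<pi> xs = xs'"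
    by (rule mset_eq_permutation)
  have s: "signof \<pi> * signof \<pi> = (1 :: 'a)" by (simp add: sign_def)
  have "list_det G xs' ys = signof \<pi> * list_det G xs ys" if "length ys = length xs"
    for G :: "'i \<Rightarrow> 'j \<Rightarrow> 'a" and ys
  proof -
    have l: "length xs' = length xs" using \<pi>(2) by auto
    have n: "xs' ! i = xs ! \<pi> i" "\<pi> i < length xs" if "i < length xs" for i
      using permute_list_nth[OF \<pi>(1) that] \<pi> that permutes_in_image[OF \<pi>(1), of i] by auto
    have "\<pi> permutes {0..<length xs}" using \<pi>(1) by (simp add: atLeast0LessThan)
    from det_permute_rows[OF _ this, of "mat (length xs) (length xs) (\<lambda>(a, b). G (xs ! a) (ys ! b))"]
    have "signof \<pi> * list_det G xs ys = det (mat (length xs) (length xs) (\<lambda>(i, j).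
        mat (length xs) (length xs) (\<lambda>(a, b). G (xs ! a) (ys ! b)) $$ (\<pi> i, j)))"
      by (simp add: list_det_def)
    also have "\<dots> = list_det G xs' ys"
      unfolding list_det_def l by (rule arg_cong[where f = det], rule cong_mat) (auto simp: n)
    finally show ?thesis by simp
  qed
  with s show ?thesis by (rule that)
qed

lemma list_det_permute:
  assumes "distinct xs" "distinct xs'" "set xs = set xs'"
    and "distinct ys" "distinct ys'" "set ys = set ys'"
    and "length xs = length ys"
  obtains \<epsilon> :: "'a :: idom" where "\<epsilon> * \<epsilon> = 1"
    "\<And>G :: 'i \<Rightarrow> 'j \<Rightarrow> 'a. list_det G xs' ys' = \<epsilon> * list_det G xs ys"
proof -
  obtain \<epsilon> :: 'a where e: "\<epsilon> * \<epsilon> = 1"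
    "\<And>G :: 'i \<Rightarrow> 'j \<Rightarrow> 'a. \<And>ys. length ys = length xs \<Longrightarrow> list_det G xs' ys = \<epsilon> * list_det G xs ys"
    using list_det_permute_rows[OF assms(1-3)] by metis
  obtain \<delta> :: 'a where d: "\<delta> * \<delta> = 1"
    "\<And>G :: 'j \<Rightarrow> 'i \<Rightarrow> 'a. \<And>xs. length xs = length ys \<Longrightarrow> list_det G ys' xs = \<delta> * list_det G ys xs"
    using list_det_permute_rows[OF assms(4-6)] by metis
  have l: "length xs' = length xs" "length ys' = length ys"
    using assms by (metis distinct_card)+
  show ?thesis
  proof (rule that)
    have "\<delta> * \<epsilon> * (\<delta> * \<epsilon>) = (\<delta> * \<delta>) * (\<epsilon> * \<epsilon>)" by (simp add: mult_ac)
    then show "\<delta> * \<epsilon> * (\<delta> * \<epsilon>) = 1" by (simp add: e d)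
    fix G :: "'i \<Rightarrow> 'j \<Rightarrow> 'a"
    have "list_det G xs' ys' = list_det (\<lambda>y x. G x y) ys' xs'"
      using l assms by (intro list_det_transpose[symmetric]) simp
    also have "\<dots> = \<delta> * list_det (\<lambda>y x. G x y) ys xs'" using l assms by (intro d) simp
    also have "list_det (\<lambda>y x. G x y) ys xs' = list_det G xs' ys"
      using l assms by (intro list_det_transpose) simp
    also have "\<dots> = \<epsilon> * list_det G xs ys" using assms by (intro e) simp
    finally show "list_det G xs' ys' = \<delta> * \<epsilon> * list_det G xs ys" by (simp add: mult.assoc)
  qed
qed

section \<open>Row elimination and Schur complements\<close>

lemma list_det_eliminate_column:
  fixes G :: "'i \<Rightarrow> 'j \<Rightarrow> 'a :: field"
  assumes "p \<notin> set xs" "length ys = Suc (length xs)"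
  shows "list_det (\<lambda>x y. if x = p then G p y / g else G x y - h x * G p y / g) (p # xs) ys
    = list_det G (p # xs) ys / g"
proof -
  define zs where "zs = p # xs"
  define n where "n = length zs"
  define A where "A = mat n n (\<lambda>(a, b). G (zs ! a) (ys ! b))"
  \<comment> \<open>Left multiplication by \<open>L\<close> divides the pivot row by
    \<open>g\<close> and subtracts \<open>h x\<close> times the result from every other row
    \<open>x\<close>. The multipliers \<open>h\<close> need not form a column of the matrix; this is
    used when the pivot column is absent from it.\<close>
  define L where "L = mat n n (\<lambda>(a, b). if b = 0 then if a = 0 then 1 / g else - h (zs ! a) / g
    else if a = b then 1 else 0)"
  have n: "0 < n" and z0: "zs ! 0 = p" by (simp_all add: n_def zs_def)
  have ne: "zs ! a \<noteq> p" if "a < n" "a \<noteq> 0" for a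
    using that assms(1) by (cases a) (auto simp: in_set_conv_nth n_def zs_def)
  have LA: "(L * A) $$ (a, b) = (if zs ! a = p then G p (ys ! b) / g
      else G (zs ! a) (ys ! b) - h (zs ! a) * G p (ys ! b) / g)"
    if ab: "a < n" "b < n" for a b
  proof -
    have "(L * A) $$ (a, b) = (\<Sum>i\<in>{0..<n}. L $$ (a, i) * G (zs ! i) (ys ! b))"
      using ab by (auto simp: scalar_prod_def L_def A_def intro!: sum.cong)
    also have "\<dots> = L $$ (a, 0) * G p (ys ! b) + (\<Sum>i\<in>{1..<n}. L $$ (a, i) * G (zs ! i) (ys ! b))"
      using n by (simp add: sum.atLeast_Suc_lessThan z0)
    also have "(\<Sum>i\<in>{1..<n}. L $$ (a, i) * G (zs ! i) (ys ! b))
        = (\<Sum>i\<in>{1..<n}. if i = a then G (zs ! a) (ys ! b) else 0)"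
      using ab by (intro sum.cong) (auto simp: L_def)
    also have "\<dots> = (if a = 0 then 0 else G (zs ! a) (ys ! b))"
      using ab by (simp add: sum.delta)
    finally show ?thesis
      using ab ne[of a] z0 by (cases "a = 0") (simp_all add: L_def)
  qed
  have "mat n n (\<lambda>(a, b). if zs ! a = p then G p (ys ! b) / g
      else G (zs ! a) (ys ! b) - h (zs ! a) * G p (ys ! b) / g) = L * A"
    by (rule eq_matI, subst LA) (simp_all add: L_def A_def)
  then have "list_det (\<lambda>x y. if x = p then G p y / g else G x y - h x * G p y / g) zs ys = det (L * A)"
    unfolding list_det_def n_def by simp
  also have "\<dots> = det L * det A"
    by (rule det_mult[of _ n]) (simp_all add: L_def A_def)
  also have "det L = prod_list (diag_mat L)"
    by (rule det_lower_triangular[of n]) (auto simp: L_def)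
  also have "\<dots> = (\<Prod>i = 0..<n. L $$ (i, i))"
    by (simp add: prod_list_diag_prod L_def)
  also have "\<dots> = 1 / g * (\<Prod>i = Suc 0..<n. L $$ (i, i))"
    using n by (simp add: prod.atLeast_Suc_lessThan L_def)
  also have "(\<Prod>i = Suc 0..<n. L $$ (i, i)) = 1"
    by (rule prod.neutral) (auto simp: L_def)
  finally show ?thesis by (simp add: list_det_def A_def n_def zs_def)
qed

lemma list_det_Cons_unit_column:
  fixes G :: "'i \<Rightarrow> 'j \<Rightarrow> 'a :: comm_ring_1"
  assumes "G p q = 1" "\<And>x. x \<in> set xs \<Longrightarrow> G x q = 0"
  shows "list_det G (p # xs) (q # ys) = list_det G xs ys"
proof -
  let ?n = "length (p # xs)"
  let ?A = "mat ?n ?n (\<lambda>(a, b). G ((p # xs) ! a) ((q # ys) ! b))"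
  have "det ?A = (\<Sum>i<?n. ?A $$ (i, 0) * cofactor ?A i 0)"
    by (rule laplace_expansion_column) auto
  also have "\<dots> = (\<Sum>i<?n. if i = 0 then cofactor ?A 0 0 else 0)"
    using assms by (intro sum.cong) (auto simp: nth_Cons split: nat.splits)
  also have "\<dots> = det (mat_delete ?A 0 0)"
    by (simp add: cofactor_def)
  also have "mat_delete ?A 0 0 = mat (length xs) (length xs) (\<lambda>(a, b). G (xs ! a) (ys ! b))"
    by (intro eq_matI) (auto simp: mat_delete_def)
  finally show ?thesis by (simp add: list_det_def)
qed

text \<open>Elimination with the multipliers \<open>G x q\<close> turns column \<open>q\<close> into
  the first unit vector, and the Laplace expansion along it leaves the Schur complement of the entry
  \<open>G p q\<close>.\<close>

lemma list_det_Schur: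
  fixes G :: "'i \<Rightarrow> 'j \<Rightarrow> 'a :: field"
  assumes "p \<notin> set xs" "length xs = length ys" "G p q \<noteq> 0"
  shows "list_det (\<lambda>x y. G x y - G x q * G p y / G p q) xs ys = list_det G (p # xs) (q # ys) / G p q"
proof -
  let ?G = "\<lambda>x y. if x = p then G p y / G p q else G x y - G x q * G p y / G p q"
  have "list_det G (p # xs) (q # ys) / G p q = list_det ?G (p # xs) (q # ys)"
    using assms by (intro list_det_eliminate_column[symmetric]) auto
  also have "\<dots> = list_det ?G xs ys"
    using assms by (intro list_det_Cons_unit_column) auto
  also have "\<dots> = list_det (\<lambda>x y. G x y - G x q * G p y / G p q) xs ys"
    using assms by (intro list_det_cong) auto
  finally show ?thesis by simp
qed

lemma list_det_eliminate_row:
  fixes G :: "'i \<Rightarrow> 'j \<Rightarrow> 'a :: field"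
  assumes "q \<notin> set ys" "length xs = Suc (length ys)"
  shows "list_det (\<lambda>x y. if y = q then G x q / g else G x y - G x q * h y / g) xs (q # ys)
    = list_det G xs (q # ys) / g"
proof -
  have "(\<lambda>y x. if y = q then G x q / g else G x y - h y * G x q / g)
      = (\<lambda>y x. if y = q then G x q / g else G x y - G x q * h y / g)"
    by (simp add: fun_eq_iff mult.commute)
  moreover have "list_det (\<lambda>y x. if y = q then G x q / g else G x y - h y * G x q / g) (q # ys) xs
      = list_det (\<lambda>y x. G x y) (q # ys) xs / g"
    using assms by (rule list_det_eliminate_column)
  ultimately show ?thesis
    using assms list_det_transpose[of xs "q # ys" G]
      list_det_transpose[of xs "q # ys" "\<lambda>x y. if y = q then G x q / g else G x y - G x q * h y / g"]
    by simp
qed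

section \<open>Reflections as adjacent transpositions\<close>

definition adj_swap :: "int \<Rightarrow> int \<Rightarrow> int" where
  "adj_swap i j = (if j = i then i + 1 else if j = i + 1 then i else j)"

lemma adj_swap_adj_swap [simp]: "adj_swap i (adj_swap i j) = j"
  by (simp add: adj_swap_def)

lemma inj_adj_swap: "inj_on (adj_swap i) A"
  by (metis adj_swap_adj_swap inj_onI)

lemma image_adj_swap: "adj_swap i ` A = {j. adj_swap i j \<in> A}"
  using image_eqI[of _ "adj_swap i" "adj_swap i _"] by auto

lemma image_adj_swap_same: "(i \<in> A) = (i + 1 \<in> A) \<Longrightarrow> adj_swap i ` A = A"
  unfolding image_adj_swap by (auto simp: adj_swap_def)

lemma image_adj_swap_up: "i \<in> A \<Longrightarrow> i + 1 \<notin> A \<Longrightarrow> adj_swap i ` A = insert (i + 1) (A - {i})"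
  unfolding image_adj_swap by (auto simp: adj_swap_def split: if_splits)

lemma image_adj_swap_down: "i \<notin> A \<Longrightarrow> i + 1 \<in> A \<Longrightarrow> adj_swap i ` A = insert i (A - {i + 1})"
  unfolding image_adj_swap by (auto simp: adj_swap_def split: if_splits)

lemma adj_swap_pos: "i \<noteq> 0 \<Longrightarrow> 0 < adj_swap i x \<longleftrightarrow> 0 < x"
  by (auto simp: adj_swap_def)

lemma adj_swap_nonpos: "i \<noteq> 0 \<Longrightarrow> adj_swap i x \<le> 0 \<longleftrightarrow> x \<le> 0"
  by (auto simp: adj_swap_def)

section \<open>Differences of the formal weights in the field\<close>

lemma v_diff_self [simp]: "v_diff a a = 0"
  by (simp add: v_diff_def)

lemma v_diff_minus: "v_diff b a = - v_diff a b"
  by (auto simp: v_diff_def)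

lemma v_diff_step: "v_diff a (b + 1) = v_diff a b + \<alpha> b"
proof (cases "a \<le> b")
  case True
  then have "{a..<b + 1} = insert b {a..<b}" by auto
  with True show ?thesis by (simp add: v_diff_def)
next
  case False
  then have "{b..<a} = insert b {b + 1..<a}" by auto
  with False show ?thesis by (auto simp: v_diff_def)
qed

lemma v_diff_triangle: "v_diff a b + v_diff b c = v_diff a c"
proof (induction c rule: int_induct[of _ b])
  case (step2 i)
  then show ?case using v_diff_step[of a "i - 1"] v_diff_step[of b "i - 1"] by simp
qed (simp_all add: v_diff_step flip: add.assoc)

lemma v_diff_adjacent [simp]: "v_diff a (a + 1) = \<alpha> a"
  using v_diff_step[of a a] by simp

text \<open>With a base point \<open>c\<close> fixed, \<open>v_diff a c\<close> plays the part of
  the weight indexed by \<open>a\<close>. Identities between products of differences thereby become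
  plain ring identities.\<close>

lemma v_diff_potential: "v_diff a b = v_diff a c - v_diff b c"
  using v_diff_triangle[of a c b] v_diff_minus[of b c] by simp

lemma reflection_alpha: "reflection i (\<alpha> b) = v_diff (adj_swap i b) (adj_swap i (b + 1))"
proof -
  have "v_diff i (i + 2) = \<alpha> i + \<alpha> (i + 1)"
    using v_diff_step[of i "i + 1"] by (simp add: add.assoc)
  then have 2: "v_diff i (i + 2) = \<alpha> (i + 1) + \<alpha> i" "v_diff i (2 + i) = \<alpha> (i + 1) + \<alpha> i"
    by (simp_all only: add.commute)
  have 3: "v_diff (i - 1) (i + 1) = \<alpha> (i - 1) + \<alpha> i"
    using v_diff_step[of "i - 1" i] v_diff_adjacent[of "i - 1"] by simp
  consider "b = i" | "b = i + 1" | "b = i - 1" | "b \<notin> {i, i + 1, i - 1}" by blast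
  then show ?thesis
    using 2 3 v_diff_minus[of "i + 1" i]
    by cases (auto simp: reflection_gen adj_swap_def)
qed

text \<open>By additivity of \<open>v_diff\<close>, moving \<open>b\<close> away from
  \<open>a\<close> one step at a time, upwards or downwards, reduces the claim to
  \<open>reflection_alpha\<close>.\<close>

lemma reflection_v_diff: "reflection i (v_diff a b) = v_diff (adj_swap i a) (adj_swap i b)"
proof (induction b rule: int_induct[of _ a])
  case base
  show ?case by simp
next
  case (step1 j)
  have "reflection i (\<alpha> j) = v_diff (adj_swap i j) (adj_swap i (j + 1))"
    by (rule reflection_alpha)
  with step1 show ?case
    by (simp add: v_diff_step reflection.hom_add v_diff_triangle)
next
  case (step2 j)
  have "reflection i (\<alpha> (j - 1)) = v_diff (adj_swap i (j - 1)) (adj_swap i j)"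
    using reflection_alpha[of i "j - 1"] by simp
  moreover have "v_diff a (j - 1) = v_diff a j - \<alpha> (j - 1)" using v_diff_step[of a "j - 1"] by simp
  ultimately show ?case
    using step2 v_diff_potential[of "adj_swap i a" "adj_swap i (j - 1)" "adj_swap i j"]
      v_diff_minus[of "adj_swap i (j - 1)" "adj_swap i j"]
    by (simp add: reflection.hom_minus)
qed

text \<open>For \<open>a < b\<close> the automorphism \<open>reflection b\<close> carries
  \<open>v_diff a (b + 1)\<close> to \<open>v_diff a b\<close>, so nonvanishing descends to the
  indeterminate \<open>\<alpha> a\<close>.\<close>

lemma v_diff_eq_0_iff [simp]: "v_diff a b = 0 \<longleftrightarrow> a = b"
proof -
  have less: "v_diff a b \<noteq> 0" if "a < b" for a b
  proof -
    have "a + 1 \<le> b" using that by simp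
    then show ?thesis
    proof (induction b rule: int_ge_induct)
      case (step b)
      then have "reflection b (v_diff a (b + 1)) = v_diff a b"
        by (simp add: reflection_v_diff adj_swap_def)
      with step show ?case by (metis reflection.hom_zero)
    qed simp
  qed
  show ?thesis
    using less[of a b] less[of b a] v_diff_minus[of a b] by (cases a b rule: linorder_cases) auto
qed

lemma reflection_reflection [simp]: "reflection i (reflection i x) = x"
  using reflection_square[of i] by (simp add: fun_eq_iff)

lemma reflection_swap: "j \<noteq> i + 1 \<Longrightarrow> j \<noteq> i - 1 \<Longrightarrow> reflection i (reflection j x) = reflection j (reflection i x)"
  using reflection_commute[of j i] by (simp add: fun_eq_iff)

lemma reflection_braid': "reflection i (reflection (i + 1) (reflection i x))
    = reflection (i + 1) (reflection i (reflection (i + 1) x))"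
  using reflection_braid[of i] by (simp add: fun_eq_iff)

lemma reflection_act_commute:
  assumes "\<And>j. j \<in> set js \<Longrightarrow> j \<noteq> i + 1 \<and> j \<noteq> i - 1"
  shows "reflection i (act (prod_list (map sgen js)) x) = act (prod_list (map sgen js)) (reflection i x)"
  using assms by (induction js) (simp_all add: act_mult act_sgen reflection_swap)


section \<open>Permutations and Maya diagrams under left multiplication by a generator\<close>

lemma weight_act_simps: "weight_act 1 x = x" "weight_act (sgen i * w) x = weight_reflection i (weight_act w x)"
  by (transfer, simp)+

lemma perm_of_one [simp]: "perm_of 1 j = j"
  using weight_act_v_wt[of 1 j] by (simp add: weight_act_simps v_wt_inj)

lemma perm_of_sgen: "perm_of (sgen i * w) j = adj_swap i (perm_of w j)"
proof -
  have "v_wt (perm_of (sgen i * w) j) = weight_reflection i (v_wt (perm_of w j))"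
    by (simp only: weight_act_simps flip: weight_act_v_wt)
  then show ?thesis by (simp add: weight_reflection_v_wt v_wt_inj adj_swap_def)
qed

lemma maya_one: "maya 1 = {..0}"
  by (simp add: maya_def)

lemma maya_sgen: "maya (sgen i * w) = adj_swap i ` maya w"
  by (simp add: maya_def perm_of_sgen image_image)

section \<open>Hook functions\<close>

text \<open>\<open>hook_tau p y\<close> is the translate of \<open>\<tau>\<^sub>0\<close> whose Maya diagram arises from \<open>\<int>\<^sub>\<le>\<^sub>0\<close> by replacing \<open>y \<le> 0\<close> by \<open>p > 0\<close>.\<close>

definition hook_tau :: "int \<Rightarrow> int \<Rightarrow> ratfun" where
  "hook_tau p y = act (hook p (- y)) (\<tau> 0)"

lemma hook_tau_nonzero [simp]: "hook_tau p y \<noteq> 0"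
proof -
  have "act w x \<noteq> 0" if "x \<noteq> 0" for w x
    by (induction w rule: weyl_induct) (use that in \<open>simp_all add: act_mult act_sgen\<close>)
  then show ?thesis by (simp add: hook_tau_def)
qed

lemma reflection_tau_0: "i \<noteq> 0 \<Longrightarrow> reflection i (\<tau> 0) = \<tau> 0"
  by (simp add: reflection_gen)

lemma hook_tau_1_0: "hook_tau 1 0 = reflection 0 (\<tau> 0)"
  by (simp add: hook_tau_def hook_def act_sgen)

text \<open>The new letter \<open>sgen p\<close> stands between the two blocks of the word. Its
  index differs by at least 2 from every index \<open>y, ..., -1\<close> of the left block, so it
  can be moved to the front.\<close>

lemma hook_tau_Suc:
  assumes "1 \<le> p" "y \<le> 0"
  shows "hook_tau (p + 1) y = reflection p (hook_tau p y)"
proof -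
  have "[0..p + 1 - 1] = [0..p - 1] @ [p]"
    using upto_rec2[of 0 p] assms by simp
  then show ?thesis
    using assms reflection_act_commute[of "[y..-1]" p]
    by (simp add: hook_tau_def hook_def act_mult act_sgen)
qed

lemma hook_tau_pred:
  assumes "y \<le> 0"
  shows "hook_tau p (y - 1) = reflection (y - 1) (hook_tau p y)"
proof -
  have "[- (- (y - 1))..-1] = (y - 1) # [y..-1]"
    using upto_rec1[of "y - 1" "-1"] assms by simp
  then show ?thesis
    by (simp add: hook_tau_def hook_def act_mult act_sgen mult.assoc)
qed

text \<open>Induction on \<open>p\<close>, peeling off the letters \<open>p - 1, p - 2, ...\<close>
  from the front. Unless \<open>p = i + 2\<close>, the reflection \<open>i\<close> commutes past the
  first letter. For \<open>p = i + 2\<close> two letters are peeled off, and the braid relation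
  turns \<open>i\<close> into \<open>i + 1\<close>, which fixes \<open>hook_tau i y\<close> by
  induction.\<close>

lemma reflection_hook_tau_pos:
  assumes "1 \<le> p" "y \<le> 0" "1 \<le> i" "p \<noteq> i" "p \<noteq> i + 1"
  shows "reflection i (hook_tau p y) = hook_tau p y"
  using assms(1,3-5)
proof (induction "nat p" arbitrary: p i rule: less_induct)
  case less
  consider "p = 1" | "p = i + 2" | "p \<noteq> 1" "p \<noteq> i + 2" by blast
  then show ?case
  proof cases
    case 1
    then show ?thesis
      using less.prems reflection_act_commute[of "[y..-1]" i]
      by (simp add: hook_tau_def hook_def act_mult act_sgen reflection_swap[of 0 i] reflection_tau_0)
  next
    case 2
    have "reflection (i + 1) (hook_tau i y) = hook_tau i y"
      using less.prems 2 by (intro less.hyps) auto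
    moreover have "hook_tau p y = reflection (i + 1) (reflection i (hook_tau i y))"
      using less.prems assms(2) hook_tau_Suc[of i y] hook_tau_Suc[of "i + 1" y]
      by (simp add: 2 add.assoc)
    ultimately show ?thesis using reflection_braid'[of i "hook_tau i y"] by simp
  next
    case 3
    have "reflection i (hook_tau (p - 1) y) = hook_tau (p - 1) y"
      using less.prems 3 by (intro less.hyps) auto
    moreover have "hook_tau p y = reflection (p - 1) (hook_tau (p - 1) y)"
      using less.prems assms(2) 3 hook_tau_Suc[of "p - 1" y] by simp
    ultimately show ?thesis
      using less.prems 3 by (simp add: reflection_swap[of "p - 1" i])
  qed
qed

lemma reflection_hook_tau_neg:
  assumes "1 \<le> p" "y \<le> 0" "i \<le> -1" "y \<noteq> i" "y \<noteq> i + 1"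
  shows "reflection i (hook_tau p y) = hook_tau p y"
  using assms(2-5)
proof (induction "nat (- y)" arbitrary: y i rule: less_induct)
  case less
  consider "y = 0" | "y = i - 1" | "y \<noteq> 0" "y \<noteq> i - 1" by blast
  then show ?case
  proof cases
    case 1
    then show ?thesis
      using less.prems reflection_act_commute[of "rev [0..p - 1]" i]
      by (simp add: hook_tau_def hook_def reflection_tau_0)
  next
    case 2
    have "reflection (i - 1) (hook_tau p (i + 1)) = hook_tau p (i + 1)"
      using less.prems 2 by (intro less.hyps) auto
    moreover have "hook_tau p y = reflection (i - 1) (reflection i (hook_tau p (i + 1)))"
      using less.prems hook_tau_pred[of i p] hook_tau_pred[of "i + 1" p] by (simp add: 2)
    ultimately show ?thesis using reflection_braid'[of "i - 1" "hook_tau p (i + 1)"] by simp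
  next
    case 3
    have "reflection i (hook_tau p (y + 1)) = hook_tau p (y + 1)"
      using less.prems 3 by (intro less.hyps) auto
    moreover have "hook_tau p y = reflection y (hook_tau p (y + 1))"
      using less.prems 3 hook_tau_pred[of "y + 1" p] by simp
    ultimately show ?thesis
      using less.prems 3 by (simp add: reflection_swap[of y i])
  qed
qed

text \<open>For \<open>i > 0\<close> both \<open>i\<close> and \<open>i + 1\<close> are positive,
  and for \<open>i < 0\<close> both are nonpositive. Hence only \<open>p\<close> can move in the
  first case and only \<open>y\<close> in the second, by one of the recursions or its
  inverse.\<close>

lemma reflection_hook_tau:
  assumes "1 \<le> p" "y \<le> 0" "i \<noteq> 0"
  shows "reflection i (hook_tau p y) = hook_tau (adj_swap i p) (adj_swap i y)"
proof (cases "i > 0")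
  case True
  consider "p = i" | "p = i + 1" | "p \<noteq> i" "p \<noteq> i + 1" by blast
  then show ?thesis
  proof cases
    case 1
    with True assms show ?thesis by (simp add: adj_swap_def hook_tau_Suc)
  next
    case 2
    with True assms show ?thesis by (simp add: adj_swap_def hook_tau_Suc)
  next
    case 3
    with True assms show ?thesis by (simp add: adj_swap_def reflection_hook_tau_pos)
  qed
next
  case False
  with assms have i: "i \<le> -1" by simp
  consider "y = i" | "y = i + 1" | "y \<noteq> i" "y \<noteq> i + 1" by blast
  then show ?thesis
  proof cases
    case 1
    with i assms hook_tau_pred[of "i + 1" p] show ?thesis by (simp add: adj_swap_def)
  next
    case 2
    with i assms hook_tau_pred[of "i + 1" p] show ?thesis by (simp add: adj_swap_def)
  next
    case 3
    with i assms show ?thesis by (simp add: adj_swap_def reflection_hook_tau_neg)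
  qed
qed

section \<open>The reflection 0 on hook functions and the three-term relation\<close>

lemma reflection_0_arm:
  assumes "2 \<le> p"
  shows "reflection 0 (hook_tau p 0) = hook_tau p 0"
  using assms
proof (induction p rule: int_ge_induct)
  case base
  \<comment> \<open>The braid relation replaces the letters 0, 1, 0 by 1, 0, 1, and the last letter
    1 fixes \<open>\<tau> 0\<close>. On the Maya diagram, positions 0 and 1 are both empty.\<close>
  show ?case
    using hook_tau_Suc[of 1 0] reflection_braid'[of 0 "\<tau> 0"]
    by (simp add: hook_tau_1_0 reflection_tau_0)
next
  case (step p)
  then show ?case by (simp add: hook_tau_Suc reflection_swap[of p 0])
qed

lemma reflection_0_leg:
  assumes "y \<le> -1"
  shows "reflection 0 (hook_tau 1 y) = hook_tau 1 y"
  using assms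
proof (induction y rule: int_le_induct)
  case base
  show ?case
    using hook_tau_pred[of 0 1] reflection_braid'[of "-1" "\<tau> 0"]
    by (simp add: hook_tau_1_0 reflection_tau_0)
next
  case (step y)
  then show ?case by (simp add: hook_tau_pred reflection_swap[of "y - 1" 0])
qed

text \<open>The reflected hook has the beads 1 and \<open>p\<close> and the holes 0 and
  \<open>y\<close>, so this is the determinant formula of size 2 with denominators cleared. The
  Cauchy determinant on the left is evaluated by \<open>v_diff_exchange\<close>.\<close>

definition plucker :: "int \<Rightarrow> int \<Rightarrow> bool" where
  "plucker p y \<longleftrightarrow> reflection 0 (hook_tau p y) * \<tau> 0 * (v_diff 0 y * v_diff p 1)
    = hook_tau p y * hook_tau 1 0 * (v_diff 0 p * v_diff y 1)
      - hook_tau p 0 * hook_tau 1 y * (v_diff y p * v_diff 0 1)"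

text \<open>The polynomial content of the relation at \<open>(2, -1)\<close>: the letters
  \<open>f\<close>, \<open>F\<close>, \<open>G\<close> are \<open>\<ff> 0\<close>,
  \<open>\<ff> 1\<close>, \<open>\<ff> (-1)\<close>, and \<open>a\<close>, \<open>b\<close>,
  \<open>c\<close> are \<open>\<alpha> 0\<close>, \<open>\<alpha> 1\<close>,
  \<open>\<alpha> (-1)\<close>. The left side contains the images of these under
  \<open>reflection 0\<close>.\<close>

lemma plucker_algebra:
  fixes f F G a b c :: "'a :: field"
  assumes "f \<noteq> 0"
  shows "(f * (G - a / f) * (F + a / f) + (c + a) * (F + a / f) - (b + a) * (G - a / f)) * f * (c * b)
    = (f * G * F + c * F - b * G) * f * ((a + b) * (c + a))
      - (f * F - b) * (f * G + c) * ((c + a + b) * a)"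
proof -
  have "(f * (G - a / f) * (F + a / f) + (c + a) * (F + a / f) - (b + a) * (G - a / f)) * f
      = (f * G - a) * (f * F + a) + (c + a) * (f * F + a) - (b + a) * (f * G - a)"
    using assms by (simp add: field_simps)
  then show ?thesis by (simp only:) (simp add: algebra_simps)
qed

lemma clear_denominators:
  fixes f F G :: "'a :: field"
  assumes "F \<noteq> 0" "G \<noteq> 0"
  shows "(f + c / G - b / F) * (G * u) * (F * w) = (f * G * F + c * F - b * G) * (u * w)"
  using assms by (simp add: field_simps)

lemma plucker_base: "plucker 2 (-1)"
proof -
  have v: "v_diff 0 (-1) = - \<alpha> (-1)" "v_diff 2 1 = - \<alpha> 1" "v_diff 0 2 = \<alpha> 0 + \<alpha> 1"
    "v_diff (-1) 1 = \<alpha> (-1) + \<alpha> 0" "v_diff (-1) 2 = \<alpha> (-1) + \<alpha> 0 + \<alpha> 1" "v_diff 0 1 = \<alpha> 0"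
    using v_diff_minus[of 0 "-1"] v_diff_minus[of 2 1] v_diff_adjacent[of "-1"] v_diff_adjacent[of 1]
      v_diff_adjacent[of 0] v_diff_step[of 0 1] v_diff_step[of "-1" 0] v_diff_step[of "-1" 1]
    by simp_all
  have t10: "hook_tau 1 0 = \<ff> 0 * \<tau> (-1) * \<tau> 1 / \<tau> 0"
    by (simp add: hook_tau_1_0 reflection_gen)
  have t20: "hook_tau 2 0 = (\<ff> 0 - \<alpha> 1 / \<ff> 1) * \<tau> (-1) * (\<ff> 1 * \<tau> 2 / \<tau> 1)"
    using hook_tau_Suc[of 1 0] by (simp add: t10 reflection_gen reflection_distribs)
  have t11: "hook_tau 1 (-1) = (\<ff> 0 + \<alpha> (-1) / \<ff> (-1)) * (\<ff> (-1) * \<tau> (-2) / \<tau> (-1)) * \<tau> 1"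
    using hook_tau_pred[of 0 1] by (simp add: t10 reflection_gen reflection_distribs)
  have t21: "hook_tau 2 (-1) = (\<ff> 0 + \<alpha> (-1) / \<ff> (-1) - \<alpha> 1 / \<ff> 1) * (\<ff> (-1) * \<tau> (-2) / \<tau> (-1))
      * (\<ff> 1 * \<tau> 2 / \<tau> 1) * \<tau> 0"
    using hook_tau_pred[of 0 2] by (simp add: t20 reflection_gen reflection_distribs)
  \<comment> \<open>Both expressions are images of indeterminates under \<open>reflection 0\<close>,
    which is injective.\<close>
  have nz: "\<ff> (-1) - \<alpha> 0 / \<ff> 0 \<noteq> 0" "\<ff> 1 + \<alpha> 0 / \<ff> 0 \<noteq> 0"
    using reflection.hom_0_iff[of 0 "\<ff> (-1)"] reflection.hom_0_iff[of 0 "\<ff> 1"]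
    by (simp_all add: reflection_gen)
  have "reflection 0 (hook_tau 2 (-1)) = (\<ff> 0 + (\<alpha> (-1) + \<alpha> 0) / (\<ff> (-1) - \<alpha> 0 / \<ff> 0)
      - (\<alpha> 1 + \<alpha> 0) / (\<ff> 1 + \<alpha> 0 / \<ff> 0)) * ((\<ff> (-1) - \<alpha> 0 / \<ff> 0) * (\<tau> (-2) / \<tau> (-1)))
      * ((\<ff> 1 + \<alpha> 0 / \<ff> 0) * (\<tau> 2 / \<tau> 1)) * (\<ff> 0 * \<tau> (-1) * \<tau> 1 / \<tau> 0)"
    by (simp add: t21 reflection_gen reflection_distribs)
  also have "\<dots> = (\<ff> 0 * (\<ff> (-1) - \<alpha> 0 / \<ff> 0) * (\<ff> 1 + \<alpha> 0 / \<ff> 0)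
      + (\<alpha> (-1) + \<alpha> 0) * (\<ff> 1 + \<alpha> 0 / \<ff> 0) - (\<alpha> 1 + \<alpha> 0) * (\<ff> (-1) - \<alpha> 0 / \<ff> 0)) * \<ff> 0
      * (\<tau> (-2) * \<tau> 2 / \<tau> 0)"
    unfolding clear_denominators[OF nz(2,1)] by simp
  \<comment> \<open>The minus signs of \<open>v_diff 0 (-1)\<close> and \<open>v_diff 2 1\<close>
    cancel in their product.\<close>
  finally have "reflection 0 (hook_tau 2 (-1)) * \<tau> 0 * (\<alpha> (-1) * \<alpha> 1)
      = ((\<ff> 0 * (\<ff> (-1) - \<alpha> 0 / \<ff> 0) * (\<ff> 1 + \<alpha> 0 / \<ff> 0)
      + (\<alpha> (-1) + \<alpha> 0) * (\<ff> 1 + \<alpha> 0 / \<ff> 0) - (\<alpha> 1 + \<alpha> 0) * (\<ff> (-1) - \<alpha> 0 / \<ff> 0)) * \<ff> 0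
      * (\<alpha> (-1) * \<alpha> 1)) * (\<tau> (-2) * \<tau> 2)" by simp
  also have "\<dots> = (\<ff> 0 * \<ff> (-1) * \<ff> 1 + \<alpha> (-1) * \<ff> 1 - \<alpha> 1 * \<ff> (-1)) * (\<tau> (-2) * \<tau> 2) * \<ff> 0
        * ((\<alpha> 0 + \<alpha> 1) * (\<alpha> (-1) + \<alpha> 0))
      - (\<ff> 0 * \<ff> 1 - \<alpha> 1) * (\<ff> 0 * \<ff> (-1) + \<alpha> (-1)) * (\<tau> (-2) * \<tau> 2)
        * ((\<alpha> (-1) + \<alpha> 0 + \<alpha> 1) * \<alpha> 0)"
    by (subst plucker_algebra, simp) (simp add: algebra_simps)
  also have "(\<ff> 0 * \<ff> (-1) * \<ff> 1 + \<alpha> (-1) * \<ff> 1 - \<alpha> 1 * \<ff> (-1)) * (\<tau> (-2) * \<tau> 2) * \<ff> 0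
      = hook_tau 2 (-1) * hook_tau 1 0"
  proof -
    have "hook_tau 2 (-1) = (\<ff> 0 + \<alpha> (-1) / \<ff> (-1) - \<alpha> 1 / \<ff> 1) * (\<ff> (-1) * (\<tau> (-2) / \<tau> (-1)))
      * (\<ff> 1 * (\<tau> 2 / \<tau> 1)) * \<tau> 0" by (simp add: t21)
    also have "\<dots> = (\<ff> 0 * \<ff> (-1) * \<ff> 1 + \<alpha> (-1) * \<ff> 1 - \<alpha> 1 * \<ff> (-1))
      * ((\<tau> (-2) / \<tau> (-1)) * (\<tau> 2 / \<tau> 1)) * \<tau> 0"
      by (subst clear_denominators) simp_all
    finally show ?thesis by (simp add: t10)
  qed
  also have "(\<ff> 0 * \<ff> 1 - \<alpha> 1) * (\<ff> 0 * \<ff> (-1) + \<alpha> (-1)) * (\<tau> (-2) * \<tau> 2)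
      = hook_tau 2 0 * hook_tau 1 (-1)"
  proof -
    have "hook_tau 2 0 = (\<ff> 0 * \<ff> 1 - \<alpha> 1) * (\<tau> (-1) * \<tau> 2 / \<tau> 1)"
      by (simp add: t20 field_simps)
    moreover have "hook_tau 1 (-1) = (\<ff> 0 * \<ff> (-1) + \<alpha> (-1)) * (\<tau> (-2) * \<tau> 1 / \<tau> (-1))"
      by (simp add: t11 field_simps)
    ultimately show ?thesis by simp
  qed
  finally show ?thesis by (simp add: plucker_def v mult_ac)
qed

text \<open>For \<open>y \<le> -1\<close> and \<open>p \<ge> 2\<close> the reflections
  \<open>y - 1\<close> and \<open>p\<close> commute with \<open>reflection 0\<close>, fix
  \<open>\<tau> 0\<close> and leave the labels 0 and 1 alone. Applying them to the relation
  therefore only replaces \<open>y\<close> by \<open>y - 1\<close> or \<open>p\<close> by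
  \<open>p + 1\<close>.\<close>

lemma plucker_relation:
  assumes "2 \<le> p" "y \<le> -1"
  shows "plucker p y"
proof -
  have "plucker 2 y"
    using assms(2)
  proof (induction y rule: int_le_induct)
    case base
    show ?case by (rule plucker_base)
  next
    case (step y)
    from arg_cong[OF step(2)[unfolded plucker_def], of "reflection (y - 1)"] step(1) show ?case
      by (simp add: plucker_def reflection_distribs reflection_swap[of 0 "y - 1"] reflection_hook_tau
        reflection_v_diff reflection_tau_0 adj_swap_def)
  qed
  with assms(1) show ?thesis
  proof (induction p rule: int_ge_induct)
    case (step p)
    from arg_cong[OF step(2)[OF step(3), unfolded plucker_def], of "reflection p"] step(1) assms(2) show ?case
      by (simp add: plucker_def reflection_distribs reflection_swap[of 0 p] reflection_hook_tau
        reflection_v_diff reflection_tau_0 adj_swap_def)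
  qed
qed

section \<open>The pivot transform\<close>

text \<open>The generic quotient has denominator zero at \<open>p = 1\<close>. The value there, and
  the one of \<open>col_scale\<close> at \<open>y = 0\<close>, are those that make the pivot row and
  the pivot column of the Cauchy matrix transform correctly.\<close>

definition row_scale :: "int \<Rightarrow> ratfun" where
  "row_scale p = (if p = 1 then - 1 / v_diff 0 1 else v_diff 0 p / v_diff p 1)"

definition col_scale :: "int \<Rightarrow> ratfun" where
  "col_scale y = (if y = 0 then - 1 / v_diff 0 1 else v_diff y 1 / v_diff 0 y)"

text \<open>Under \<open>s\<^sub>0\<close> the matrix undergoes, up to row and column factors, the principal pivot transform at
  the entry \<open>(1, 0)\<close>.\<close>

definition pivots :: "(int \<Rightarrow> int \<Rightarrow> ratfun) \<Rightarrow> bool" where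
  "pivots G \<longleftrightarrow> G 1 0 \<noteq> 0 \<and> (\<forall>p\<ge>1. \<forall>y\<le>0. reflection 0 (G p y) = row_scale p * col_scale y *
    (if p = 1 \<and> y = 0 then - 1 / G 1 0 else if p = 1 then G 1 y / G 1 0
     else if y = 0 then G p 0 / G 1 0 else G p y - G p 0 * G 1 y / G 1 0))"

definition cauchy_entry :: "int \<Rightarrow> int \<Rightarrow> ratfun" where
  "cauchy_entry p y = 1 / v_diff y p"

definition hook_entry :: "int \<Rightarrow> int \<Rightarrow> ratfun" where
  "hook_entry p y = hook_tau p y / (\<tau> 0 * v_diff y p)"

text \<open>Dividing the three-term relation by its denominators gives the pivot form of a generic
  entry. Setting \<open>a\<close>, \<open>t\<close>, \<open>h\<close>, \<open>k\<close>,
  \<open>m\<close>, \<open>n\<close> all to 1 gives the case of the Cauchy matrix, where the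
  hypothesis becomes \<open>v_diff_exchange\<close>.\<close>

lemma pivot_algebra:
  fixes a t U V A B C D h k m n :: "'a :: field"
  assumes "a * t * (U * V) = h * k * (A * B) - m * n * (C * D)"
    and "t \<noteq> 0" "k \<noteq> 0" "A \<noteq> 0" "B \<noteq> 0" "C \<noteq> 0" "D \<noteq> 0" "U \<noteq> 0" "V \<noteq> 0"
  shows "a / (k * C) = A / V * (B / U) * (h / (t * C) - m / (t * A) * (n / (t * B)) / (k / (t * D)))"
proof -
  have "A / V * (B / U) * (h / (t * C) - m / (t * A) * (n / (t * B)) / (k / (t * D)))
      = (h * k * (A * B) - m * n * (C * D)) / (U * V * (t * (C * k)))"
    using assms(2-) by (simp add: field_simps)
  also have "\<dots> = a * t * (U * V) / (U * V * (t * (C * k)))"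
    by (simp only: assms(1))
  also have "\<dots> = a / (k * C)"
    using assms(2-) by (simp add: field_simps)
  finally show ?thesis ..
qed

lemma v_diff_exchange: "v_diff 0 y * v_diff p 1 = v_diff 0 p * v_diff y 1 - v_diff y p * v_diff 0 1"
proof -
  define V where "V a = v_diff a 0" for a
  have V: "v_diff a b = V a - V b" for a b unfolding V_def by (rule v_diff_potential)
  show ?thesis unfolding V by (simp add: algebra_simps)
qed

lemma pivots_cauchy_entry: "pivots cauchy_entry"
  unfolding pivots_def
proof (intro conjI allI impI)
  show "cauchy_entry 1 0 \<noteq> 0" by (simp add: cauchy_entry_def)
  fix p y :: int
  assume py: "1 \<le> p" "y \<le> 0"
  have s: "reflection 0 (cauchy_entry p y) = 1 / v_diff (adj_swap 0 y) (adj_swap 0 p)"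
    by (simp add: cauchy_entry_def reflection_distribs reflection_v_diff)
  have neg: "v_diff 1 0 = - v_diff 0 1" "v_diff 1 p = - v_diff p 1" "v_diff y 0 = - v_diff 0 y"
    by (rule v_diff_minus)+
  consider "p = 1" "y = 0" | "p = 1" "y \<le> -1" | "2 \<le> p" "y = 0" | "2 \<le> p" "y \<le> -1" using py by linarith
  then show "reflection 0 (cauchy_entry p y) = row_scale p * col_scale y *
    (if p = 1 \<and> y = 0 then - 1 / cauchy_entry 1 0 else if p = 1 then cauchy_entry 1 y / cauchy_entry 1 0
     else if y = 0 then cauchy_entry p 0 / cauchy_entry 1 0
     else cauchy_entry p y - cauchy_entry p 0 * cauchy_entry 1 y / cauchy_entry 1 0)"
  proof cases
    case 4
    have "1 / (1 * v_diff y p) = v_diff 0 p / v_diff p 1 * (v_diff y 1 / v_diff 0 y) * (1 / (1 * v_diff y p)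
        - 1 / (1 * v_diff 0 p) * (1 / (1 * v_diff y 1)) / (1 / (1 * v_diff 0 1)))"
      by (rule pivot_algebra) (use 4 v_diff_exchange[of y p] in simp_all)
    with 4 show ?thesis
      unfolding s by (simp add: adj_swap_def row_scale_def col_scale_def cauchy_entry_def)
  qed (unfold s, simp_all add: neg adj_swap_def row_scale_def col_scale_def cauchy_entry_def)
qed

lemma pivots_hook_entry: "pivots hook_entry"
  unfolding pivots_def
proof (intro conjI allI impI)
  show "hook_entry 1 0 \<noteq> 0" by (simp add: hook_entry_def)
  fix p y :: int
  assume py: "1 \<le> p" "y \<le> 0"
  have s: "reflection 0 (hook_entry p y)
      = reflection 0 (hook_tau p y) / (hook_tau 1 0 * v_diff (adj_swap 0 y) (adj_swap 0 p))"
    by (simp add: hook_entry_def reflection_distribs reflection_v_diff hook_tau_1_0)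
  have s10: "reflection 0 (hook_tau 1 0) = \<tau> 0" by (simp add: hook_tau_1_0)
  have neg: "v_diff 1 0 = - v_diff 0 1" "v_diff 1 p = - v_diff p 1" "v_diff y 0 = - v_diff 0 y"
    by (rule v_diff_minus)+
  consider "p = 1" "y = 0" | "p = 1" "y \<le> -1" | "2 \<le> p" "y = 0" | "2 \<le> p" "y \<le> -1" using py by linarith
  then show "reflection 0 (hook_entry p y) = row_scale p * col_scale y *
    (if p = 1 \<and> y = 0 then - 1 / hook_entry 1 0 else if p = 1 then hook_entry 1 y / hook_entry 1 0
     else if y = 0 then hook_entry p 0 / hook_entry 1 0
     else hook_entry p y - hook_entry p 0 * hook_entry 1 y / hook_entry 1 0)"
  proof cases
    case 1
    then show ?thesis
      unfolding s by (simp add: s10 neg adj_swap_def row_scale_def col_scale_def hook_entry_def)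
  next
    case 2
    then show ?thesis
      unfolding s by (simp add: reflection_0_leg neg adj_swap_def row_scale_def col_scale_def hook_entry_def)
  next
    case 3
    then show ?thesis
      unfolding s by (simp add: reflection_0_arm neg adj_swap_def row_scale_def col_scale_def hook_entry_def)
  next
    case 4
    have "reflection 0 (hook_tau p y) / (hook_tau 1 0 * v_diff y p)
      = v_diff 0 p / v_diff p 1 * (v_diff y 1 / v_diff 0 y) * (hook_tau p y / (\<tau> 0 * v_diff y p)
        - hook_tau p 0 / (\<tau> 0 * v_diff 0 p) * (hook_tau 1 y / (\<tau> 0 * v_diff y 1))
          / (hook_tau 1 0 / (\<tau> 0 * v_diff 0 1)))"
      by (rule pivot_algebra) (use 4 plucker_relation[of p y] in \<open>simp_all add: plucker_def\<close>)
    with 4 show ?thesis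
      unfolding s by (simp add: adj_swap_def row_scale_def col_scale_def hook_entry_def)
  qed
qed

section \<open>The effect of the reflection 0 on determinants\<close>

definition scale :: "int list \<Rightarrow> int list \<Rightarrow> ratfun" where
  "scale xs ys = prod_list (map row_scale xs) * prod_list (map col_scale ys)"

lemma scale_nonzero:
  assumes "set xs \<subseteq> {1..}" "set ys \<subseteq> {..0}"
  shows "scale xs ys \<noteq> 0"
proof -
  have "0 \<notin> set xs" "1 \<notin> set ys" using assms by auto
  then show ?thesis
    by (auto simp: scale_def row_scale_def col_scale_def split: if_splits)
qed

lemma reflection_0_list_det:
  assumes "pivots G" "set xs \<subseteq> {1..}" "set ys \<subseteq> {..0}" "length xs = length ys"
  shows "reflection 0 (list_det G xs ys) = scale xs ys * list_det (\<lambda>p y.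
    if p = 1 \<and> y = 0 then - 1 / G 1 0 else if p = 1 then G 1 y / G 1 0
     else if y = 0 then G p 0 / G 1 0 else G p y - G p 0 * G 1 y / G 1 0) xs ys" (is "_ = _ * list_det ?G xs ys")
proof -
  have "reflection 0 (list_det G xs ys) = list_det (\<lambda>p y. row_scale p * col_scale y * ?G p y) xs ys"
    unfolding reflection.hom_list_det
    using assms by (intro list_det_cong) (simp_all add: pivots_def subset_iff)
  also have "\<dots> = scale xs ys * list_det ?G xs ys"
    unfolding scale_def using assms(4) by (rule list_det_scale)
  finally show ?thesis .
qed

text \<open>With row 1 and column 0 both absent, the transformed entries form the Schur complement
  of the entry \<open>(1, 0)\<close> in the matrix enlarged by that row and column.\<close>

lemma reflection_0_list_det_neither:
  assumes "pivots G" "set xs \<subseteq> {1..}" "set ys \<subseteq> {..0}" "length xs = length ys" "1 \<notin> set xs" "0 \<notin> set ys"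
  shows "reflection 0 (list_det G xs ys) * G 1 0 = scale xs ys * list_det G (1 # xs) (0 # ys)"
proof -
  have "list_det (\<lambda>p y. if p = 1 \<and> y = 0 then - 1 / G 1 0 else if p = 1 then G 1 y / G 1 0
     else if y = 0 then G p 0 / G 1 0 else G p y - G p 0 * G 1 y / G 1 0) xs ys
    = list_det (\<lambda>p y. G p y - G p 0 * G 1 y / G 1 0) xs ys"
    using assms by (intro list_det_cong) auto
  also have "\<dots> = list_det G (1 # xs) (0 # ys) / G 1 0"
    using assms by (intro list_det_Schur) (auto simp: pivots_def)
  finally show ?thesis
    using assms by (simp add: reflection_0_list_det pivots_def)
qed

text \<open>With row 1 present and column 0 absent, the transform is an elimination by row 1 whose
  multipliers \<open>G p 0\<close> come from outside the matrix. The labels therefore stay the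
  same.\<close>

lemma reflection_0_list_det_row:
  assumes "pivots G" "set xs \<subseteq> {1..}" "set ys \<subseteq> {..0}" "length ys = Suc (length xs)" "1 \<notin> set xs" "0 \<notin> set ys"
  shows "reflection 0 (list_det G (1 # xs) ys) * G 1 0 = scale (1 # xs) ys * list_det G (1 # xs) ys"
proof -
  have "list_det (\<lambda>p y. if p = 1 \<and> y = 0 then - 1 / G 1 0 else if p = 1 then G 1 y / G 1 0
     else if y = 0 then G p 0 / G 1 0 else G p y - G p 0 * G 1 y / G 1 0) (1 # xs) ys
    = list_det (\<lambda>p y. if p = 1 then G 1 y / G 1 0 else G p y - G p 0 * G 1 y / G 1 0) (1 # xs) ys"
    using assms by (intro list_det_cong) auto
  also have "\<dots> = list_det G (1 # xs) ys / G 1 0"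
    using assms by (intro list_det_eliminate_column) auto
  finally show ?thesis
    using assms by (simp add: reflection_0_list_det pivots_def)
qed

lemma reflection_0_list_det_col:
  assumes "pivots G" "set xs \<subseteq> {1..}" "set ys \<subseteq> {..0}" "length xs = Suc (length ys)" "1 \<notin> set xs" "0 \<notin> set ys"
  shows "reflection 0 (list_det G xs (0 # ys)) * G 1 0 = scale xs (0 # ys) * list_det G xs (0 # ys)"
proof -
  have "list_det (\<lambda>p y. if p = 1 \<and> y = 0 then - 1 / G 1 0 else if p = 1 then G 1 y / G 1 0
     else if y = 0 then G p 0 / G 1 0 else G p y - G p 0 * G 1 y / G 1 0) xs (0 # ys)
    = list_det (\<lambda>p y. if y = 0 then G p 0 / G 1 0 else G p y - G p 0 * G 1 y / G 1 0) xs (0 # ys)"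
    using assms by (intro list_det_cong) auto
  also have "\<dots> = list_det G xs (0 # ys) / G 1 0"
    using assms by (intro list_det_eliminate_row) auto
  finally show ?thesis
    using assms by (simp add: reflection_0_list_det pivots_def)
qed


section \<open>The determinant formula for the tau functions\<close>

text \<open>The lists give positive beads and nonpositive holes in any order. This lets the labels 1
  and 0 be moved to the front when needed; having lists also records that both sets are
  finite.\<close>

definition frobenius_lists :: "int set \<Rightarrow> int list \<Rightarrow> int list \<Rightarrow> bool" where
  "frobenius_lists M xs ys \<longleftrightarrow> distinct xs \<and> distinct ys \<and> length xs = length ys \<and>
    set xs = M \<inter> {0<..} \<and> set ys = {..0} - M"

text \<open>The form without division is convenient for the induction; the Cauchy determinant is
  seen to be nonzero only afterwards, through \<open>hook_factor_list_det\<close>.\<close>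

definition tau_formula :: "ratfun \<Rightarrow> int list \<Rightarrow> int list \<Rightarrow> bool" where
  "tau_formula t xs ys \<longleftrightarrow> t * list_det cauchy_entry xs ys = \<tau> 0 * list_det hook_entry xs ys"

lemma tau_formula_permute:
  assumes "frobenius_lists M xs ys" "frobenius_lists M xs' ys'" "tau_formula t xs ys"
  shows "tau_formula t xs' ys'"
proof -
  obtain \<epsilon> where \<epsilon>: "\<epsilon> * \<epsilon> = 1"
    "\<And>G :: int \<Rightarrow> int \<Rightarrow> ratfun. list_det G xs' ys' = \<epsilon> * list_det G xs ys"
    using assms(1,2) list_det_permute[of xs xs' ys ys' thesis] unfolding frobenius_lists_def by auto
  then show ?thesis using assms(3) unfolding tau_formula_def \<epsilon>(2) by (metis mult.left_commute)
qed

lemma reflection_tau_formula: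
  assumes "i \<noteq> 0" "frobenius_lists M xs ys" "tau_formula t xs ys"
  shows "frobenius_lists (adj_swap i ` M) (map (adj_swap i) xs) (map (adj_swap i) ys)"
    and "tau_formula (reflection i t) (map (adj_swap i) xs) (map (adj_swap i) ys)"
proof -
  show "frobenius_lists (adj_swap i ` M) (map (adj_swap i) xs) (map (adj_swap i) ys)"
    using assms(1,2) unfolding frobenius_lists_def
    by (auto simp: distinct_map inj_adj_swap image_adj_swap adj_swap_pos adj_swap_nonpos)
  have l: "length xs = length ys" and xs: "\<And>x. x \<in> set xs \<Longrightarrow> 1 \<le> x" and ys: "\<And>y. y \<in> set ys \<Longrightarrow> y \<le> 0"
    using assms(2) by (auto simp: frobenius_lists_def)
  have "list_det (\<lambda>x y. reflection i (hook_entry x y)) xs ys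
      = list_det (\<lambda>x y. hook_entry (adj_swap i x) (adj_swap i y)) xs ys"
    using assms(1) l xs ys by (intro list_det_cong)
      (simp_all add: hook_entry_def reflection_distribs reflection_hook_tau reflection_tau_0 reflection_v_diff)
  moreover have "list_det (\<lambda>x y. reflection i (cauchy_entry x y)) xs ys
      = list_det (\<lambda>x y. cauchy_entry (adj_swap i x) (adj_swap i y)) xs ys"
    using l by (intro list_det_cong) (simp_all add: cauchy_entry_def reflection_distribs reflection_v_diff)
  moreover note arg_cong[OF assms(3)[unfolded tau_formula_def], of "reflection i"]
  ultimately show "tau_formula (reflection i t) (map (adj_swap i) xs) (map (adj_swap i) ys)"
    using assms(1) l
    by (simp add: tau_formula_def list_det_map reflection.hom_mult reflection.hom_list_det reflection_tau_0)
qed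

lemma move_to_front:
  assumes "x \<in> set xs" "distinct xs"
  shows "distinct (x # remove1 x xs)" "set (x # remove1 x xs) = set xs" "length (x # remove1 x xs) = length xs"
  using assms length_pos_if_in_set[OF assms(1)] by (auto simp: length_remove1)

text \<open>The two reflected determinants equal \<open>R * c' / c10\<close> and
  \<open>R * h' / h10\<close> with a common \<open>R\<close>. The remaining discrepancy
  \<open>h10 / c10\<close> is exactly the ratio of \<open>t0'\<close>, the reflected
  \<open>\<tau> 0\<close>, to \<open>t0\<close>.\<close>

lemma pivot_tau_formula:
  fixes t c h c' h' c10 h10 R t0 t0' :: "'a :: field"
  assumes "t * c = t0' * h" "c * c10 = R * c'" "h * h10 = R * h'" "t0' = t0 * h10 / c10"
    and "R \<noteq> 0" "c10 \<noteq> 0" "h10 \<noteq> 0"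
  shows "t * c' = t0 * h'"
proof -
  have "R * (t * c') = t * c * c10" using assms(2) by (simp add: mult_ac)
  also have "\<dots> = t0 * (h * h10)" using assms(6) by (simp add: assms(1,4))
  also have "\<dots> = R * (t0 * h')" by (simp add: assms(3))
  finally show ?thesis using assms(5) by simp
qed

lemma hook_tau_1_0_entries: "hook_tau 1 0 = \<tau> 0 * hook_entry 1 0 / cauchy_entry 1 0"
  by (simp add: hook_entry_def cauchy_entry_def)

text \<open>Whether 0 and 1 are beads decides the case: the matrices gain row 1 and column 0, keep
  their labels, or lose this row and column.\<close>

lemma reflection_0_tau_formula:
  assumes "frobenius_lists M xs ys" "tau_formula t xs ys"
  shows "\<exists>xs ys. frobenius_lists (adj_swap 0 ` M) xs ys \<and> tau_formula (reflection 0 t) xs ys"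
proof -
  note pc = pivots_cauchy_entry and ph = pivots_hook_entry
  have nz: "cauchy_entry 1 0 \<noteq> 0" "hook_entry 1 0 \<noteq> 0"
    using pc ph by (auto simp: pivots_def)
  have 0: "reflection 0 t * reflection 0 (list_det cauchy_entry xs ys)
      = hook_tau 1 0 * reflection 0 (list_det hook_entry xs ys)" if "tau_formula t xs ys" for xs ys
    using arg_cong[OF that[unfolded tau_formula_def], of "reflection 0"]
    by (simp add: reflection.hom_mult hook_tau_1_0)
  have reorder: "tau_formula t xs' ys'" if "frobenius_lists M xs' ys'" for xs' ys'
    using tau_formula_permute assms that by blast
  have s: "set xs \<subseteq> {1..}" "set ys \<subseteq> {..0}" "length xs = length ys" "distinct xs" "distinct ys"
    using assms(1) by (auto simp: frobenius_lists_def)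
  consider "1 \<notin> M" "0 \<in> M" | "1 \<in> M" "0 \<in> M" | "1 \<notin> M" "0 \<notin> M" | "1 \<in> M" "0 \<notin> M" by blast
  then show ?thesis
  proof cases
    case 1
    have n: "1 \<notin> set xs" "0 \<notin> set ys" using 1 assms(1) by (auto simp: frobenius_lists_def)
    have "frobenius_lists (adj_swap 0 ` M) (1 # xs) (0 # ys)"
      using assms(1) n 1 image_adj_swap_up[of 0 M] unfolding frobenius_lists_def by auto
    moreover have "tau_formula (reflection 0 t) (1 # xs) (0 # ys)"
      unfolding tau_formula_def
      by (rule pivot_tau_formula[OF 0[OF assms(2)] reflection_0_list_det_neither[OF pc]
            reflection_0_list_det_neither[OF ph] hook_tau_1_0_entries])
        (use s n nz scale_nonzero[of xs ys] in simp_all)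
    ultimately show ?thesis by blast
  next
    case 2
    define xs' where "xs' = remove1 1 xs"
    have x: "distinct (1 # xs')" "set (1 # xs') = set xs" "length (1 # xs') = length xs"
      unfolding xs'_def by (rule move_to_front; use 2 assms(1) in \<open>simp add: frobenius_lists_def\<close>)+
    have n: "0 \<notin> set ys" using 2 assms(1) by (auto simp: frobenius_lists_def)
    have fl: "frobenius_lists M (1 # xs') ys" using assms(1) x by (simp add: frobenius_lists_def)
    moreover have "adj_swap 0 ` M = M" using 2 by (intro image_adj_swap_same) simp
    moreover have "tau_formula (reflection 0 t) (1 # xs') ys"
      unfolding tau_formula_def
      by (rule pivot_tau_formula[OF 0[OF reorder[OF fl]] reflection_0_list_det_row[OF pc]
            reflection_0_list_det_row[OF ph] hook_tau_1_0_entries])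
        (use s n nz x scale_nonzero[of "1 # xs'" ys] in auto)
    ultimately show ?thesis by auto
  next
    case 3
    define ys' where "ys' = remove1 0 ys"
    have y: "distinct (0 # ys')" "set (0 # ys') = set ys" "length (0 # ys') = length ys"
      unfolding ys'_def by (rule move_to_front; use 3 assms(1) in \<open>simp add: frobenius_lists_def\<close>)+
    have n: "1 \<notin> set xs" using 3 assms(1) by (auto simp: frobenius_lists_def)
    have fl: "frobenius_lists M xs (0 # ys')" using assms(1) y by (simp add: frobenius_lists_def)
    moreover have "adj_swap 0 ` M = M" using 3 by (intro image_adj_swap_same) simp
    moreover have "tau_formula (reflection 0 t) xs (0 # ys')"
      unfolding tau_formula_def
      by (rule pivot_tau_formula[OF 0[OF reorder[OF fl]] reflection_0_list_det_col[OF pc]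
            reflection_0_list_det_col[OF ph] hook_tau_1_0_entries])
        (use s n nz y scale_nonzero[of xs "0 # ys'"] in auto)
    ultimately show ?thesis by auto
  next
    case 4
    define xs' where "xs' = remove1 1 xs"
    define ys' where "ys' = remove1 0 ys"
    have x: "distinct (1 # xs')" "set (1 # xs') = set xs" "length (1 # xs') = length xs"
      unfolding xs'_def by (rule move_to_front; use 4 assms(1) in \<open>simp add: frobenius_lists_def\<close>)+
    have y: "distinct (0 # ys')" "set (0 # ys') = set ys" "length (0 # ys') = length ys"
      unfolding ys'_def by (rule move_to_front; use 4 assms(1) in \<open>simp add: frobenius_lists_def\<close>)+
    have fl: "frobenius_lists M (1 # xs') (0 # ys')" using assms(1) x y by (simp add: frobenius_lists_def)
    have xy: "set xs' = M \<inter> {0<..} - {1}" "set ys' = {..0} - M - {0}"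
      using assms(1) x y by (auto simp: frobenius_lists_def)
    have "frobenius_lists (adj_swap 0 ` M) xs' ys'"
      using x y s(3) xy image_adj_swap_down[of 0 M] 4 unfolding frobenius_lists_def by auto
    moreover have "reflection 0 t * list_det cauchy_entry xs' ys' = \<tau> 0 * list_det hook_entry xs' ys'"
    proof -
      have sub: "set xs' \<subseteq> {1..}" "set ys' \<subseteq> {..0}" "length xs' = length ys'" "1 \<notin> set xs'" "0 \<notin> set ys'"
        using s x y xy by auto
      \<comment> \<open>Losing the pivot row and column is the reverse of gaining them: the relation
        for the smaller matrix is reflected once more, \<open>reflection 0\<close> being an
        involution.\<close>
      have piv: "list_det G xs' ys' * reflection 0 (G 1 0)
          = reflection 0 (scale xs' ys') * reflection 0 (list_det G (1 # xs') (0 # ys'))" if "pivots G" for G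
        using arg_cong[OF reflection_0_list_det_neither[OF that sub], of "reflection 0"]
        by (simp add: reflection.hom_mult)
      have h0: "\<tau> 0 = hook_tau 1 0 * reflection 0 (hook_entry 1 0) / reflection 0 (cauchy_entry 1 0)"
        using arg_cong[OF hook_tau_1_0_entries, of "reflection 0"]
        by (simp add: hook_tau_1_0 reflection_distribs)
      have "reflection 0 t * list_det cauchy_entry xs' ys' * reflection 0 (cauchy_entry 1 0)
          = reflection 0 (scale xs' ys') * (reflection 0 t * reflection 0 (list_det cauchy_entry (1 # xs') (0 # ys')))"
        using piv[OF pc] by (simp add: mult_ac)
      also have "\<dots> = reflection 0 (scale xs' ys') * (hook_tau 1 0 * reflection 0 (list_det hook_entry (1 # xs') (0 # ys')))"
        by (simp only: 0[OF reorder[OF fl]])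
      also have "\<dots> = hook_tau 1 0 * (list_det hook_entry xs' ys' * reflection 0 (hook_entry 1 0))"
        by (simp add: piv[OF ph] mult.left_commute)
      also have "\<dots> = \<tau> 0 * list_det hook_entry xs' ys' * reflection 0 (cauchy_entry 1 0)"
        using nz by (subst h0) simp
      finally show ?thesis using nz by simp
    qed
    ultimately show ?thesis unfolding tau_formula_def by blast
  qed
qed

lemma act_tau_formula:
  "\<exists>xs ys. frobenius_lists (maya w) xs ys \<and> tau_formula (act w (\<tau> 0)) xs ys"
proof (induction w rule: weyl_induct)
  case one
  show ?case
    by (intro exI[of _ "[]"]) (auto simp: frobenius_lists_def tau_formula_def maya_one)
next
  case (sgen i w)
  then obtain xs ys where xy: "frobenius_lists (maya w) xs ys" "tau_formula (act w (\<tau> 0)) xs ys" by blast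
  show ?case
    unfolding maya_sgen act_mult act_sgen
    using reflection_tau_formula[OF _ xy] reflection_0_tau_formula[OF xy] by (cases "i = 0") blast+
qed

section \<open>Partitions and their Maya diagrams\<close>

lemma part_antimono:
  assumes "is_partition \<mu>" "1 \<le> i" "i \<le> j"
  shows "part \<mu> j \<le> part \<mu> i"
proof (cases "i < j \<and> j \<le> length \<mu>")
  case True
  then show ?thesis
    using assms sorted_wrt_nth_less[of "(\<ge>)" \<mu> "i - 1" "j - 1"]
    by (auto simp: is_partition_def part_def)
next
  case False
  with assms show ?thesis by (cases "i = j") (auto simp: part_def)
qed

lemma part_pos_iff: "is_partition \<mu> \<Longrightarrow> 0 < part \<mu> i \<longleftrightarrow> 1 \<le> i \<and> i \<le> length \<mu>"
  by (auto simp: part_def is_partition_def)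

lemma mem_young: "is_partition \<mu> \<Longrightarrow> (i, j) \<in> young \<mu> \<longleftrightarrow> 1 \<le> i \<and> 1 \<le> j \<and> j \<le> part \<mu> i"
  using part_pos_iff[of \<mu> i] by (auto simp: young_def)

lemma down_closed_nat_eq:
  fixes A :: "nat set"
  assumes "finite A" "0 \<notin> A" "\<And>i k. k \<in> A \<Longrightarrow> 1 \<le> i \<Longrightarrow> i \<le> k \<Longrightarrow> i \<in> A"
  shows "A = {1..card A}"
proof -
  have "A = {1..Max (insert 0 A)}"
  proof (cases "A = {}")
    case False
    with assms(1) have "Max (insert 0 A) \<in> A" by (simp add: max_def)
    with assms show ?thesis
      by (auto simp: Suc_le_eq intro: ccontr)
  qed simp
  then show ?thesis by (metis card_atLeastAtMost diff_Suc_1 One_nat_def)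
qed

lemma le_conj_part_iff:
  assumes "is_partition \<mu>" "1 \<le> i" "1 \<le> j"
  shows "i \<le> conj_part \<mu> j \<longleftrightarrow> j \<le> part \<mu> i"
proof -
  let ?A = "{i. (i, j) \<in> young \<mu>}"
  have "?A = {1..card ?A}"
  proof (rule down_closed_nat_eq)
    show "finite ?A" by (rule finite_subset[of _ "{..length \<mu>}"]) (auto simp: young_def)
    fix i k assume "k \<in> ?A" "1 \<le> i" "i \<le> k"
    then show "i \<in> ?A" using assms part_antimono[of \<mu> i k] by (simp add: mem_young)
  qed (simp add: young_def)
  then have "i \<in> ?A \<longleftrightarrow> i \<in> {1..conj_part \<mu> j}" by (simp add: conj_part_def)
  then show ?thesis using assms by (simp add: mem_young)
qed

lemma conj_part_antimono:
  assumes "is_partition \<mu>" "1 \<le> i" "i \<le> j"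
  shows "conj_part \<mu> j \<le> conj_part \<mu> i"
proof (cases "conj_part \<mu> j = 0")
  case False
  then have "j \<le> part \<mu> (conj_part \<mu> j)"
    using le_conj_part_iff[of \<mu> "conj_part \<mu> j" j] assms by simp
  then show ?thesis
    using le_conj_part_iff[of \<mu> "conj_part \<mu> j" i] assms False by simp
qed simp

lemma frob_arm_strict: "is_partition \<mu> \<Longrightarrow> 1 \<le> i \<Longrightarrow> i < j \<Longrightarrow> frob_arm \<mu> j < frob_arm \<mu> i"
  using part_antimono[of \<mu> i j] by (simp add: frob_arm_def)

lemma frob_leg_strict: "is_partition \<mu> \<Longrightarrow> 1 \<le> i \<Longrightarrow> i < j \<Longrightarrow> frob_leg \<mu> j < frob_leg \<mu> i"
  using conj_part_antimono[of \<mu> i j] by (simp add: frob_leg_def)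

lemma inj_frob_arm: "is_partition \<mu> \<Longrightarrow> inj_on (frob_arm \<mu>) {1..}"
  by (rule linorder_inj_onI') (metis atLeast_iff frob_arm_strict less_irrefl)

lemma inj_frob_leg: "is_partition \<mu> \<Longrightarrow> inj_on (frob_leg \<mu>) {1..}"
  by (rule linorder_inj_onI') (metis atLeast_iff frob_leg_strict less_irrefl)

text \<open>The number \<open>j - i\<close> separates the two labels. On a cell,
  \<open>- frob_leg \<mu> j \<le> j - i < frob_arm \<mu> i\<close>; off the diagram,
  \<open>frob_arm \<mu> i \<le> j - i < - frob_leg \<mu> j\<close>.\<close>

lemma hole_bead:
  assumes "is_partition \<mu>" "1 \<le> i" "1 \<le> j"
  shows "- frob_leg \<mu> j < frob_arm \<mu> i \<longleftrightarrow> (i, j) \<in> young \<mu>" "- frob_leg \<mu> j \<noteq> frob_arm \<mu> i"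
  using le_conj_part_iff[OF assms] assms by (auto simp: frob_leg_def frob_arm_def mem_young)

text \<open>All row indices are taken, not only those up to \<open>durfee \<mu>\<close>. Rows beyond
  the length contribute \<open>1 - i\<close>, so the set is the whole Maya diagram of the
  partition.\<close>

definition beads :: "nat list \<Rightarrow> int set" where
  "beads \<mu> = frob_arm \<mu> ` {1..}"

lemma holes_eq:
  assumes "is_partition \<mu>"
  shows "- beads \<mu> = (\<lambda>j. - frob_leg \<mu> j) ` {1..}"
proof
  show "(\<lambda>j. - frob_leg \<mu> j) ` {1..} \<subseteq> - beads \<mu>"
    using hole_bead(2)[OF assms] by (auto simp: beads_def)
  show "- beads \<mu> \<subseteq> (\<lambda>j. - frob_leg \<mu> j) ` {1..}"
  proof
    fix x assume x: "x \<in> - beads \<mu>"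
    let ?A = "{n. 1 \<le> n \<and> x < frob_arm \<mu> n}"
    have A: "?A = {1..card ?A}"
    proof (rule down_closed_nat_eq)
      have "frob_arm \<mu> n \<le> x" if "length \<mu> + nat (\<bar>x\<bar>) + 1 < n" for n
        using that by (simp add: frob_arm_def part_def)
      then have "?A \<subseteq> {..length \<mu> + nat (\<bar>x\<bar>) + 1}"
        by (metis (no_types, lifting) atMost_iff mem_Collect_eq not_le subsetI)
      then show "finite ?A" by (rule finite_subset) simp
      fix i k assume "k \<in> ?A" "1 \<le> i" "i \<le> k"
      then show "i \<in> ?A" using frob_arm_strict[OF assms, of i k] by (cases "i = k") auto
    qed simp
    \<comment> \<open>The hole \<open>x\<close> has \<open>i\<close> beads above it, so its column
      has height \<open>i\<close> and index \<open>x + i\<close>. The inequality \<open>up\<close>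
      below makes this index positive, so \<open>nat\<close> loses nothing.\<close>
    define i where "i = card ?A"
    have mem: "1 \<le> n \<Longrightarrow> x < frob_arm \<mu> n \<longleftrightarrow> n \<le> i" for n
      using A unfolding i_def by (metis (mono_tags, lifting) atLeastAtMost_iff mem_Collect_eq)
    have "frob_arm \<mu> (i + 1) \<noteq> x" using x by (auto simp: beads_def)
    then have up: "frob_arm \<mu> (i + 1) < x" using mem[of "i + 1"] by simp
    define j where "j = nat (x + int i)"
    have j: "int j = x + int i" "1 \<le> j" "part \<mu> (i + 1) < j"
      using up by (auto simp: frob_arm_def j_def)
    have "conj_part \<mu> j \<le> i"
      using le_conj_part_iff[OF assms, of "i + 1" j] j by simp
    moreover have "i \<le> conj_part \<mu> j"
    proof (cases "i = 0")
      case False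
      then have "x < frob_arm \<mu> i" using mem[of i] by simp
      then have "j \<le> part \<mu> i" using j(1) by (simp add: frob_arm_def)
      then show ?thesis using le_conj_part_iff[OF assms, of i j] j False by simp
    qed simp
    ultimately have "- frob_leg \<mu> j = x" using j(1) by (simp add: frob_leg_def)
    with j(2) show "x \<in> (\<lambda>j. - frob_leg \<mu> j) ` {1..}" by auto
  qed
qed

lemma le_durfee_iff:
  assumes "is_partition \<mu>" "1 \<le> i"
  shows "i \<le> durfee \<mu> \<longleftrightarrow> i \<le> part \<mu> i"
proof
  let ?A = "insert 0 {n \<in> {1..length \<mu>}. n \<le> part \<mu> n}"
  have "durfee \<mu> \<in> ?A" unfolding durfee_def by (rule Max_in) auto
  moreover assume "i \<le> durfee \<mu>"
  ultimately have "durfee \<mu> \<le> part \<mu> (durfee \<mu>)" using assms by auto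
  with \<open>i \<le> durfee \<mu>\<close> show "i \<le> part \<mu> i"
    using part_antimono[OF assms \<open>i \<le> durfee \<mu>\<close>] by simp
next
  assume "i \<le> part \<mu> i"
  then have "i \<in> {n \<in> {1..length \<mu>}. n \<le> part \<mu> n}" using assms part_pos_iff[of \<mu> i] by simp
  then show "i \<le> durfee \<mu>" unfolding durfee_def by (intro Max_ge) auto
qed

lemma frob_arm_image:
  assumes "is_partition \<mu>"
  shows "frob_arm \<mu> ` {1..durfee \<mu>} = beads \<mu> \<inter> {0<..}"
proof -
  have "0 < frob_arm \<mu> i \<longleftrightarrow> i \<le> durfee \<mu>" if "1 \<le> i" for i
    using le_durfee_iff[OF assms that] by (auto simp: frob_arm_def)
  then show ?thesis by (auto simp: beads_def)
qed

lemma frob_leg_image: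
  assumes "is_partition \<mu>"
  shows "(\<lambda>n. - frob_leg \<mu> n) ` {1..durfee \<mu>} = {..0} - beads \<mu>"
proof -
  have "0 \<le> frob_leg \<mu> j \<longleftrightarrow> j \<le> durfee \<mu>" if "1 \<le> j" for j
    using le_durfee_iff[OF assms that] le_conj_part_iff[OF assms that that] by (auto simp: frob_leg_def)
  moreover have "{..0} - beads \<mu> = (\<lambda>n. - frob_leg \<mu> n) ` {1..} \<inter> {..0}"
    using holes_eq[OF assms] by blast
  ultimately show ?thesis by auto
qed

text \<open>A strictly decreasing enumeration is determined by its range: at the first index where
  two of them could differ, each value is at most the other.\<close>

lemma beads_inj:
  assumes "is_partition \<mu>" "is_partition \<nu>" "beads \<mu> = beads \<nu>"
  shows "\<mu> = \<nu>"
proof -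
  have le: "frob_arm \<mu> i \<le> frob_arm \<nu> i"
    if h: "is_partition \<mu>" "is_partition \<nu>" "beads \<mu> = beads \<nu>" "1 \<le> i"
      "\<And>k. 1 \<le> k \<Longrightarrow> k < i \<Longrightarrow> frob_arm \<mu> k = frob_arm \<nu> k" for \<mu> \<nu> i
  proof -
    have "frob_arm \<mu> i \<in> beads \<nu>" using h(3,4) by (auto simp: beads_def)
    then obtain k where k: "1 \<le> k" "frob_arm \<mu> i = frob_arm \<nu> k" by (auto simp: beads_def)
    have "\<not> k < i" using h(5)[of k] k frob_arm_strict[OF h(1) k(1), of i] by auto
    then show ?thesis using k frob_arm_strict[OF h(2,4), of k] by (cases "k = i") auto
  qed
  have arm: "frob_arm \<mu> i = frob_arm \<nu> i" if "1 \<le> i" for i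
    using that
  proof (induction i rule: less_induct)
    case (less i)
    then show ?case using le[OF assms, of i] le[OF assms(2,1) assms(3)[symmetric], of i] by fastforce
  qed
  then have part: "part \<mu> i = part \<nu> i" if "1 \<le> i" for i
    using that by (simp add: frob_arm_def)
  have "1 \<le> i \<Longrightarrow> i \<le> length \<mu> \<longleftrightarrow> i \<le> length \<nu>" for i
    using part[of i] part_pos_iff[OF assms(1), of i] part_pos_iff[OF assms(2), of i] by simp
  from this[of "length \<mu>"] this[of "length \<nu>"] have len: "length \<mu> = length \<nu>"
    by (cases "length \<mu> = 0"; cases "length \<nu> = 0") auto
  then show ?thesis
  proof (rule nth_equalityI)
    fix i assume "i < length \<mu>"
    then show "\<mu> ! i = \<nu> ! i" using part[of "Suc i"] len by (simp add: part_def)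
  qed
qed

section \<open>From Maya diagrams to partitions\<close>

lemma partition_from_sequence:
  fixes f :: "nat \<Rightarrow> nat"
  assumes "decseq f" "f N = 0"
  obtains \<mu> where "is_partition \<mu>" "beads \<mu> = range (\<lambda>i. int (f i) - int i)"
proof -
  \<comment> \<open>The sequence counts rows from 0, so \<open>f i\<close> is part
    \<open>i + 1\<close>; its least zero is the number of positive parts.\<close>
  define L where "L = (LEAST n. f n = 0)"
  have L0: "f L = 0" unfolding L_def using assms(2) by (rule LeastI)
  have L: "0 < f i \<longleftrightarrow> i < L" for i
    using not_less_Least[of i "\<lambda>n. f n = 0"] L0 decseqD[OF assms(1), of L i] unfolding L_def[symmetric]
    by (cases "i < L") auto
  let ?\<mu> = "map f [0..<L]"
  have part: "part ?\<mu> (Suc i) = f i" for i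
    using L[of i] by (auto simp: part_def)
  have "is_partition ?\<mu>"
    unfolding is_partition_def
    using L decseqD[OF assms(1)] by (auto simp: sorted_wrt_iff_nth_less)
  moreover have "beads ?\<mu> = range (\<lambda>i. int (f i) - int i)"
  proof -
    have "{1..} = range Suc" using atLeast_Suc_greaterThan by (auto simp: image_iff Suc_le_eq gr0_conv_Suc)
    then show ?thesis by (simp add: beads_def image_image frob_arm_def part)
  qed
  ultimately show ?thesis by (rule that)
qed

text \<open>A generator either fixes the Maya diagram or moves one bead by one place, which adds a
  cell to row \<open>n\<close> of the sequence or removes one from it.\<close>

lemma maya_sequence:
  "\<exists>f N. decseq f \<and> f N = (0 :: nat) \<and> maya w = range (\<lambda>i. int (f i) - int i)"
proof (induction w rule: weyl_induct)
  case one
  have "maya 1 = range (\<lambda>i. int 0 - int i)"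
    by (auto simp: maya_one image_iff) (metis add.inverse_inverse neg_0_le_iff_le zero_le_imp_eq_int)
  then show ?case by (intro exI[of _ "\<lambda>_. 0"]) (auto simp: decseq_def)
next
  case (sgen j w)
  then obtain f N where f: "decseq f" "f N = 0" and M: "maya w = range (\<lambda>i. int (f i) - int i)" by blast
  define b where "b i = int (f i) - int i" for i
  have M: "maya w = range b" by (simp add: M b_def[abs_def])
  have b: "b k < b i" if "i < k" for i k
    using decseqD[OF f(1), of i k] that by (simp add: b_def)
  have b_inj: "b i = b k \<longleftrightarrow> i = k" for i k
    using b[of i k] b[of k i] by (cases i k rule: linorder_cases) auto
  have range_upd: "range (b(n := x)) = insert x (range b - {b n})" for n x
    using b_inj by (auto simp: fun_upd_image)
  have M': "maya (sgen j * w) = adj_swap j ` range b"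
    by (simp add: maya_sgen M)
  have dec: "decseq g" if "\<And>i. g (Suc i) \<le> g i" for g :: "nat \<Rightarrow> nat"
    using that by (simp add: decseq_SucI)
  consider "(j \<in> range b) = (j + 1 \<in> range b)" | "j \<in> range b" "j + 1 \<notin> range b"
    | "j \<notin> range b" "j + 1 \<in> range b" by blast
  then show ?case
  proof cases
    case 1
    then have "maya (sgen j * w) = maya w" unfolding M' unfolding M by (rule image_adj_swap_same)
    with f M show ?thesis unfolding b_def by blast
  next
    case 2
    then obtain n where n: "b n = j" by auto
    let ?f = "f(n := Suc (f n))"
    have "(\<lambda>i. int (?f i) - int i) = b(n := j + 1)"
      using n by (auto simp: b_def fun_eq_iff)
    then have "range (\<lambda>i. int (?f i) - int i) = insert (j + 1) (range b - {j})"
      by (simp only: range_upd n)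
    also have "\<dots> = maya (sgen j * w)"
      using 2 unfolding M' by (rule image_adj_swap_up[symmetric])
    finally have "maya (sgen j * w) = range (\<lambda>i. int (?f i) - int i)" ..
    moreover have "decseq ?f"
    proof (rule dec)
      fix i
      \<comment> \<open>Since \<open>j + 1\<close> is free, the bead before \<open>b n = j\<close>
        lies at \<open>j + 2\<close> or higher, which leaves room for the new cell.\<close>
      have "b i \<noteq> j + 1" using 2 by (metis rangeI)
      then show "?f (Suc i) \<le> ?f i"
        using decseqD[OF f(1), of i "Suc i"] n b[of i n] by (auto simp: b_def)
    qed
    \<comment> \<open>The enlarged row \<open>n\<close> may be at or beyond \<open>N\<close>, so a
      later zero is named.\<close>
    moreover have "?f (N + n + 1) = 0" using decseqD[OF f(1), of N "N + n + 1"] f(2) by simp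
    ultimately show ?thesis by blast
  next
    case 3
    then obtain n where n: "b n = j + 1" by auto
    have "b (Suc n) \<noteq> j" using 3 by (metis rangeI)
    then have Sn: "f (Suc n) < f n" using n b[of n "Suc n"] by (auto simp: b_def)
    \<comment> \<open>By \<open>Sn\<close> the row is nonempty, so the truncated subtraction is
      exact, and the next row still fits below it.\<close>
    let ?f = "f(n := f n - 1)"
    have "(\<lambda>i. int (?f i) - int i) = b(n := j)"
      using n Sn by (auto simp: b_def fun_eq_iff)
    then have "range (\<lambda>i. int (?f i) - int i) = insert j (range b - {j + 1})"
      by (simp only: range_upd n)
    also have "\<dots> = maya (sgen j * w)"
      using 3 unfolding M' by (rule image_adj_swap_down[symmetric])
    finally have "maya (sgen j * w) = range (\<lambda>i. int (?f i) - int i)" ..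
    moreover have "decseq ?f"
    proof (rule dec)
      fix i
      show "?f (Suc i) \<le> ?f i"
        using decseqD[OF f(1), of i "Suc i"] Sn by auto
    qed
    moreover have "?f N = 0" using f(2) by auto
    ultimately show ?thesis by blast
  qed
qed

text \<open>A set of integers is recovered from its positive elements and its nonpositive gaps, so
  the defining condition of \<open>partition_of\<close> says \<open>beads \<mu> = maya w\<close>.
  Existence and uniqueness are then \<open>maya_sequence\<close> with
  \<open>partition_from_sequence\<close>, and \<open>beads_inj\<close>.\<close>

lemma partition_of_maya: "is_partition (partition_of w)" "beads (partition_of w) = maya w"
proof -
  let ?P = "\<lambda>\<mu>. is_partition \<mu> \<and>
     frob_arm \<mu> ` {1..durfee \<mu>} = maya w \<inter> {0<..} \<and>
     (\<lambda>n. - frob_leg \<mu> n) ` {1..durfee \<mu>} = {..0} - maya w"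
  have P: "?P \<mu> \<longleftrightarrow> is_partition \<mu> \<and> beads \<mu> = maya w" for \<mu>
  proof (cases "is_partition \<mu>")
    case True
    have "A = (A \<inter> {0<..}) \<union> ({..0} - ({..0} - A))" for A :: "int set" by auto
    then have "beads \<mu> \<inter> {0<..} = maya w \<inter> {0<..} \<and> {..0} - beads \<mu> = {..0} - maya w \<longleftrightarrow> beads \<mu> = maya w"
      by metis
    then show ?thesis using True by (simp only: frob_arm_image frob_leg_image simp_thms)
  qed simp
  obtain f N where "decseq f" "f N = (0 :: nat)" "maya w = range (\<lambda>i. int (f i) - int i)"
    using maya_sequence by blast
  then obtain \<mu> where "is_partition \<mu>" "beads \<mu> = maya w"
    by (metis partition_from_sequence)
  then have "is_partition (partition_of w) \<and> beads (partition_of w) = maya w"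
    unfolding partition_of_def P by (rule_tac theI[of _ \<mu>]) (auto intro: beads_inj)
  then show "is_partition (partition_of w)" "beads (partition_of w) = maya w" by simp_all
qed

text \<open>The factor at the cell \<open>(i, j)\<close> is the difference between the hole of
  column \<open>j\<close> and the bead of row \<open>i\<close>, and by \<open>hole_bead\<close> the
  cells are the pairs with the hole below the bead.\<close>

lemma hook_factor_beads:
  assumes "is_partition \<mu>"
  shows "hook_factor \<mu> = (\<Prod>(a, b)\<in>{(a, b). a \<notin> beads \<mu> \<and> b \<in> beads \<mu> \<and> a < b}. v_diff a b)"
proof -
  let ?h = "\<lambda>(i, j). (- frob_leg \<mu> j, frob_arm \<mu> i)"
  have "bij_betw ?h (young \<mu>) {(a, b). a \<notin> beads \<mu> \<and> b \<in> beads \<mu> \<and> a < b}"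
    unfolding bij_betw_def
  proof
    show "inj_on ?h (young \<mu>)"
      using inj_frob_arm[OF assms] inj_frob_leg[OF assms]
      by (auto simp: inj_on_def young_def)
    have "(a, b) \<in> ?h ` young \<mu>" if "a \<notin> beads \<mu>" "b \<in> beads \<mu>" "a < b" for a b
    proof -
      obtain i where i: "1 \<le> i" "b = frob_arm \<mu> i" using \<open>b \<in> beads \<mu>\<close> by (auto simp: beads_def)
      have "a \<in> - beads \<mu>" using that by simp
      then obtain j where j: "1 \<le> j" "a = - frob_leg \<mu> j" unfolding holes_eq[OF assms] by auto
      have "(i, j) \<in> young \<mu>" using hole_bead(1)[OF assms i(1) j(1)] i j \<open>a < b\<close> by simp
      then show ?thesis using i j by force
    qed
    moreover have "- frob_leg \<mu> j \<notin> beads \<mu> \<and> frob_arm \<mu> i \<in> beads \<mu> \<and> - frob_leg \<mu> j < frob_arm \<mu> i"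
      if "(i, j) \<in> young \<mu>" for i j
      using that hole_bead[OF assms, of _ j] by (auto simp: mem_young[OF assms] beads_def)
    ultimately show "?h ` young \<mu> = {(a, b). a \<notin> beads \<mu> \<and> b \<in> beads \<mu> \<and> a < b}"
      by (fastforce simp: image_iff)
  qed
  from prod.reindex_bij_betw[OF this, of "\<lambda>(a, b). v_diff a b"] show ?thesis
    by (simp add: hook_factor_def frob_arm_def frob_leg_def case_prod_unfold)
qed

section \<open>The normalization and Cauchy's determinant\<close>

text \<open>Together with \<open>leg_factor\<close> this is the part of the normalization that
  depends on one label: for the single hook with bead \<open>p\<close> and hole \<open>y\<close> the
  full factor is \<open>v_diff y p * arm_factor p * leg_factor y\<close>.\<close>

definition arm_factor :: "int \<Rightarrow> ratfun" where
  "arm_factor p = (\<Prod>a\<in>{0<..<p}. v_diff a p)"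

definition leg_factor :: "int \<Rightarrow> ratfun" where
  "leg_factor y = (\<Prod>b\<in>{y<..0}. v_diff y b)"

definition vdm_arms :: "int set \<Rightarrow> ratfun" where
  "vdm_arms I = (\<Prod>b\<in>I. \<Prod>a\<in>{a \<in> I. a < b}. v_diff a b)"

definition vdm_legs :: "int set \<Rightarrow> ratfun" where
  "vdm_legs J = (\<Prod>a\<in>J. \<Prod>b\<in>{b \<in> J. a < b}. v_diff a b)"

lemma prod_arm_factor:
  assumes "finite I" "I \<subseteq> {0<..}"
  shows "(\<Prod>b\<in>I. arm_factor b) = (\<Prod>b\<in>I. \<Prod>a\<in>{0<..<b} - I. v_diff a b) * vdm_arms I"
proof -
  have "arm_factor b = (\<Prod>a\<in>{0<..<b} - I. v_diff a b) * (\<Prod>a\<in>{a \<in> I. a < b}. v_diff a b)" for b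
  proof -
    have "{0<..<b} - {a \<in> I. a < b} = {0<..<b} - I" by auto
    then show ?thesis
      unfolding arm_factor_def using assms by (subst prod.subset_diff[of "{a \<in> I. a < b}"]) auto
  qed
  then show ?thesis by (simp add: vdm_arms_def prod.distrib)
qed

lemma prod_leg_factor:
  assumes "finite J" "J \<subseteq> {..0}"
  shows "(\<Prod>a\<in>J. leg_factor a) = (\<Prod>a\<in>J. \<Prod>b\<in>{a<..0} - J. v_diff a b) * vdm_legs J"
proof -
  have "leg_factor a = (\<Prod>b\<in>{a<..0} - J. v_diff a b) * (\<Prod>b\<in>{b \<in> J. a < b}. v_diff a b)" for a
  proof -
    have "{a<..0} - {b \<in> J. a < b} = {a<..0} - J" by auto
    then show ?thesis
      unfolding leg_factor_def using assms by (subst prod.subset_diff[of "{b \<in> J. a < b}"]) auto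
  qed
  then show ?thesis by (simp add: vdm_legs_def prod.distrib)
qed

text \<open>A hole below a bead is of one of three kinds: nonpositive hole and positive bead, both
  positive, or both nonpositive. The Vandermonde products supply the pairs missing from the last two
  kinds, completing them to full intervals.\<close>

lemma bead_product:
  assumes "finite I" "finite J" "I = M \<inter> {0<..}" "J = {..0} - M"
  shows "(\<Prod>(a, b)\<in>{(a, b). a \<notin> M \<and> b \<in> M \<and> a < b}. v_diff a b) * (vdm_arms I * vdm_legs J)
    = (\<Prod>b\<in>I. \<Prod>a\<in>J. v_diff a b) * ((\<Prod>b\<in>I. arm_factor b) * (\<Prod>a\<in>J. leg_factor a))"
proof -
  let ?A = "(\<lambda>(b, a). (a, b)) ` (I \<times> J)"
  let ?B = "(\<lambda>(b, a). (a, b)) ` (SIGMA b:I. {0<..<b} - I)"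
  let ?C = "SIGMA a:J. {a<..0} - J"
  have sw: "inj_on (\<lambda>(b, a). (a, b)) X" for X :: "(int \<times> int) set" by (auto simp: inj_on_def)
  have "{(a, b). a \<notin> M \<and> b \<in> M \<and> a < b} = ?A \<union> ?B \<union> ?C"
  proof (rule equalityI, rule subsetI)
    fix x assume "x \<in> {(a, b). a \<notin> M \<and> b \<in> M \<and> a < b}"
    then obtain a b where "x = (a, b)" "a \<notin> M" "b \<in> M" "a < b" by blast
    then show "x \<in> ?A \<union> ?B \<union> ?C"
      using assms(3,4) by (cases "a \<le> 0"; cases "b \<le> 0") (auto simp: image_iff)
  qed (use assms(3,4) in auto)
  then have "(\<Prod>(a, b)\<in>{(a, b). a \<notin> M \<and> b \<in> M \<and> a < b}. v_diff a b)
      = (\<Prod>(a, b)\<in>?A \<union> ?B. v_diff a b) * (\<Prod>(a, b)\<in>?C. v_diff a b)"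
    using assms by (simp only:) (subst prod.union_disjoint; auto)
  also have "(\<Prod>(a, b)\<in>?A \<union> ?B. v_diff a b) = (\<Prod>(a, b)\<in>?A. v_diff a b) * (\<Prod>(a, b)\<in>?B. v_diff a b)"
    using assms by (intro prod.union_disjoint) auto
  also have "(\<Prod>(a, b)\<in>?A. v_diff a b) = (\<Prod>b\<in>I. \<Prod>a\<in>J. v_diff a b)"
    using assms(1,2) by (subst prod.reindex[OF sw]) (simp add: prod.Sigma case_prod_unfold)
  also have "(\<Prod>(a, b)\<in>?B. v_diff a b) = (\<Prod>b\<in>I. \<Prod>a\<in>{0<..<b} - I. v_diff a b)"
    using assms(1) by (subst prod.reindex[OF sw]) (simp add: prod.Sigma case_prod_unfold)
  also have "(\<Prod>(a, b)\<in>?C. v_diff a b) = (\<Prod>a\<in>J. \<Prod>b\<in>{a<..0} - J. v_diff a b)"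
    using assms(2) by (simp add: prod.Sigma)
  finally show ?thesis
    using assms by (simp add: prod_arm_factor prod_leg_factor mult_ac)
qed

section \<open>Cauchy's determinant\<close>

lemma cauchy_exchange:
  assumes "x \<noteq> q" "y \<noteq> p" "x \<noteq> y" "p \<noteq> q"
  shows "cauchy_entry x y - cauchy_entry x q * cauchy_entry p y / cauchy_entry p q
    = v_diff x p / v_diff q x * (v_diff q y / v_diff y p) * cauchy_entry x y"
proof -
  define V where "V a = v_diff a 0" for a
  have V: "v_diff a b = V a - V b" for a b unfolding V_def by (rule v_diff_potential)
  \<comment> \<open>This exchange identity makes the Schur complement of a Cauchy matrix a Cauchy
    matrix again, up to row and column factors.\<close>
  have "v_diff q x * v_diff y p - v_diff q p * v_diff y x = v_diff x p * v_diff q y"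
    unfolding V by (simp add: algebra_simps)
  moreover have "cauchy_entry x y - cauchy_entry x q * cauchy_entry p y / cauchy_entry p q
      = (v_diff q x * v_diff y p - v_diff q p * v_diff y x) / (v_diff q x * v_diff y p * v_diff y x)"
    using assms by (simp add: cauchy_entry_def divide_simps)
  ultimately show ?thesis by (simp add: cauchy_entry_def)
qed

lemma sorted_wrt_distinct: "sorted_wrt R xs \<Longrightarrow> (\<And>x. \<not> R x x) \<Longrightarrow> distinct xs"
  by (induction xs) auto

text \<open>Induction by the Schur complement at the first entry. With beads decreasing and holes
  increasing, \<open>p\<close> is the largest bead and \<open>q\<close> the smallest hole, so every
  new difference has its smaller index first and no sign arises.\<close>

lemma Cauchy_determinant:
  assumes "length xs = length ys" "sorted_wrt (>) xs" "sorted_wrt (<) ys"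
    and "set xs \<subseteq> {0<..}" "set ys \<subseteq> {..0}"
  shows "list_det cauchy_entry xs ys * (\<Prod>b\<in>set xs. \<Prod>a\<in>set ys. v_diff a b)
    = vdm_arms (set xs) * vdm_legs (set ys)"
  using assms
proof (induction xs ys rule: list_induct2)
  case Nil
  show ?case by (simp add: vdm_arms_def vdm_legs_def)
next
  case (Cons p xs q ys)
  have p: "x < p" "p \<noteq> x" if "x \<in> set xs" for x using Cons.prems that by auto
  have q: "q < y" "q \<noteq> y" if "y \<in> set ys" for y using Cons.prems that by auto
  have xy: "x \<noteq> y" "x \<noteq> q" "y \<noteq> p" if "x \<in> set xs" "y \<in> set ys" for x y
  proof -
    have "0 < x" "y \<le> 0" "0 < p" "q \<le> 0" using Cons.prems(3,4) that by auto
    then show "x \<noteq> y" "x \<noteq> q" "y \<noteq> p" by simp_all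
  qed
  have d: "distinct xs" "distinct ys" "p \<notin> set xs" "q \<notin> set ys"
    using Cons.prems p q sorted_wrt_distinct[of "(>)" xs] sorted_wrt_distinct[of "(<)" ys] by auto
  have pq: "p \<noteq> q" "v_diff q p \<noteq> 0" using Cons.prems by auto
  have "list_det cauchy_entry (p # xs) (q # ys)
      = cauchy_entry p q * list_det (\<lambda>x y. cauchy_entry x y - cauchy_entry x q * cauchy_entry p y / cauchy_entry p q) xs ys"
    using d pq Cons.hyps by (subst list_det_Schur) (auto simp: cauchy_entry_def)
  also have "list_det (\<lambda>x y. cauchy_entry x y - cauchy_entry x q * cauchy_entry p y / cauchy_entry p q) xs ys
      = list_det (\<lambda>x y. v_diff x p / v_diff q x * (v_diff q y / v_diff y p) * cauchy_entry x y) xs ys"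
    using pq xy Cons.hyps by (intro list_det_cong cauchy_exchange) auto
  also have "\<dots> = prod_list (map (\<lambda>x. v_diff x p / v_diff q x) xs)
      * prod_list (map (\<lambda>y. v_diff q y / v_diff y p) ys) * list_det cauchy_entry xs ys"
    by (rule list_det_scale) fact
  also have "\<dots> = (\<Prod>x\<in>set xs. v_diff x p) / (\<Prod>x\<in>set xs. v_diff q x)
      * ((\<Prod>y\<in>set ys. v_diff q y) / (\<Prod>y\<in>set ys. v_diff y p)) * list_det cauchy_entry xs ys"
    using d by (simp add: prod.distinct_set_conv_list[symmetric] prod_dividef)
  finally have 1: "list_det cauchy_entry (p # xs) (q # ys) = cauchy_entry p q * ((\<Prod>x\<in>set xs. v_diff x p) / (\<Prod>x\<in>set xs. v_diff q x)
      * ((\<Prod>y\<in>set ys. v_diff q y) / (\<Prod>y\<in>set ys. v_diff y p)) * list_det cauchy_entry xs ys)" .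
  have nz: "(\<Prod>x\<in>set xs. v_diff q x) \<noteq> 0" "(\<Prod>y\<in>set ys. v_diff y p) \<noteq> 0"
    using Cons.prems by (auto simp: prod_zero_iff)
  have 2: "(\<Prod>b\<in>set (p # xs). \<Prod>a\<in>set (q # ys). v_diff a b) = v_diff q p * (\<Prod>y\<in>set ys. v_diff y p)
      * (\<Prod>x\<in>set xs. v_diff q x) * (\<Prod>b\<in>set xs. \<Prod>a\<in>set ys. v_diff a b)"
    using d by (simp add: prod.distrib mult_ac)
  have 3: "vdm_arms (set (p # xs)) = (\<Prod>x\<in>set xs. v_diff x p) * vdm_arms (set xs)"
  proof -
    have "{a \<in> insert p (set xs). a < p} = set xs" using p by auto
    moreover have "{a \<in> insert p (set xs). a < b} = {a \<in> set xs. a < b}" if "b \<in> set xs" for b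
      using p[OF that] by auto
    ultimately show ?thesis using d by (simp add: vdm_arms_def)
  qed
  have 4: "vdm_legs (set (q # ys)) = (\<Prod>y\<in>set ys. v_diff q y) * vdm_legs (set ys)"
  proof -
    have "{b \<in> insert q (set ys). q < b} = set ys" using q by auto
    moreover have "{b \<in> insert q (set ys). a < b} = {b \<in> set ys. a < b}" if "a \<in> set ys" for a
      using q[OF that] by auto
    ultimately show ?thesis using d by (simp add: vdm_legs_def)
  qed
  have IH: "list_det cauchy_entry xs ys * (\<Prod>b\<in>set xs. \<Prod>a\<in>set ys. v_diff a b)
    = vdm_arms (set xs) * vdm_legs (set ys)"
    using Cons.prems by (intro Cons.IH) auto
  have "list_det cauchy_entry (p # xs) (q # ys) * (\<Prod>b\<in>set (p # xs). \<Prod>a\<in>set (q # ys). v_diff a b)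
      = (\<Prod>x\<in>set xs. v_diff x p) * (\<Prod>y\<in>set ys. v_diff q y)
        * (list_det cauchy_entry xs ys * (\<Prod>b\<in>set xs. \<Prod>a\<in>set ys. v_diff a b))"
    unfolding 1 2 using nz pq by (simp add: cauchy_entry_def)
  then show ?case unfolding IH 3 4 by (simp add: mult_ac)
qed

text \<open>The Vandermonde products and the product over all hole-bead pairs cancel between
  \<open>bead_product\<close> and \<open>Cauchy_determinant\<close>. The nonzero right side also
  shows that both factors on the left are nonzero.\<close>

lemma hook_factor_list_det:
  assumes "frobenius_lists (maya w) xs ys" "sorted_wrt (>) xs" "sorted_wrt (<) ys"
  shows "hook_factor (partition_of w) * list_det cauchy_entry xs ys
    = (\<Prod>b\<in>set xs. arm_factor b) * (\<Prod>a\<in>set ys. leg_factor a)"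
proof -
  have s: "set xs = maya w \<inter> {0<..}" "set ys = {..0} - maya w" "length xs = length ys"
    using assms(1) by (auto simp: frobenius_lists_def)
  let ?N = "hook_factor (partition_of w)" and ?C = "list_det cauchy_entry xs ys"
  let ?X = "\<Prod>b\<in>set xs. \<Prod>a\<in>set ys. v_diff a b"
  have 1: "?N * (vdm_arms (set xs) * vdm_legs (set ys))
      = ?X * ((\<Prod>b\<in>set xs. arm_factor b) * (\<Prod>a\<in>set ys. leg_factor a))"
    unfolding hook_factor_beads[OF partition_of_maya(1)] partition_of_maya(2)
    by (rule bead_product) (simp_all flip: s)
  have 2: "?C * ?X = vdm_arms (set xs) * vdm_legs (set ys)"
    by (rule Cauchy_determinant) (use assms s in auto)
  have "?X \<noteq> 0"
  proof -
    have "v_diff a b \<noteq> 0" if "b \<in> set xs" "a \<in> set ys" for a b using that s by auto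
    then show ?thesis by (auto simp: prod_zero_iff simp del: v_diff_eq_0_iff)
  qed
  moreover have "?X * (?N * ?C) = ?X * ((\<Prod>b\<in>set xs. arm_factor b) * (\<Prod>a\<in>set ys. leg_factor a))"
    unfolding 1[symmetric] 2[symmetric] by (simp only: mult_ac)
  ultimately show ?thesis by (metis mult_left_cancel)
qed

lemma arm_factor_nonzero: "arm_factor p \<noteq> 0"
  by (auto simp: arm_factor_def prod_zero_iff)

lemma leg_factor_nonzero: "leg_factor y \<noteq> 0"
  by (auto simp: leg_factor_def prod_zero_iff)


section \<open>Monomials in the tau variables\<close>

definition tau_monomial :: "weight \<Rightarrow> ratfun" where
  "tau_monomial x = (\<Prod>i\<in>Poly_Mapping.keys x. \<tau> i powi Poly_Mapping.lookup x i)"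

lemma tau_monomial_superset:
  assumes "finite S" "Poly_Mapping.keys x \<subseteq> S"
  shows "tau_monomial x = (\<Prod>i\<in>S. \<tau> i powi Poly_Mapping.lookup x i)"
  unfolding tau_monomial_def using assms by (intro prod.mono_neutral_left) (auto simp: in_keys_iff)

lemma tau_monomial_add: "tau_monomial (x + y) = tau_monomial x * tau_monomial y"
proof -
  let ?S = "Poly_Mapping.keys x \<union> Poly_Mapping.keys y"
  have "tau_monomial (x + y) = (\<Prod>i\<in>?S. \<tau> i powi Poly_Mapping.lookup (x + y) i)"
    using Poly_Mapping.keys_add[of x y] by (intro tau_monomial_superset) auto
  then show ?thesis
    by (simp add: lookup_add power_int_add prod.distrib tau_monomial_superset[of ?S])
qed

lemma tau_monomial_0 [simp]: "tau_monomial 0 = 1"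
  by (simp add: tau_monomial_def)

lemma tau_monomial_Lambda [simp]: "tau_monomial (\<Lambda> i) = \<tau> i"
  by (simp add: tau_monomial_def)

lemma tau_monomial_nonzero [simp]: "tau_monomial x \<noteq> 0"
  by (auto simp: tau_monomial_def)

lemma tau_monomial_diff: "tau_monomial (x - y) = tau_monomial x / tau_monomial y"
  using tau_monomial_add[of "x - y" y] by (simp add: field_simps)

lemma tau_monomial_sum: "tau_monomial (\<Sum>i\<in>A. h i) = (\<Prod>i\<in>A. tau_monomial (h i))"
  by (induction A rule: infinite_finite_induct) (simp_all add: tau_monomial_add)

lemma lookup_Lambda: "Poly_Mapping.lookup (\<Lambda> i) k = of_bool (i = k)"
  by simp

text \<open>Formally the weight is the sum of \<open>v_wt i\<close> over the Maya diagram, and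
  \<open>\<Lambda> k\<close> occurs only in \<open>v_wt k\<close>, with coefficient 1, and in
  \<open>v_wt (k + 1)\<close>, with coefficient -1.\<close>

lemma lookup_weight_act:
  "Poly_Mapping.lookup (weight_act w (\<Lambda> 0)) k = of_bool (k \<in> maya w) - of_bool (k + 1 \<in> maya w)"
proof (induction w arbitrary: k rule: weyl_induct)
  case one
  show ?case unfolding weight_act_simps maya_one lookup_Lambda by auto
next
  case (sgen i w)
  show ?case
    unfolding weight_act_simps lookup_weight_reflection sgen maya_sgen image_adj_swap
    by (auto simp: adj_swap_def)
qed

lemma weight_act_eq:
  assumes "finite I" "finite J" "I = maya w \<inter> {0<..}" "J = {..0} - maya w"
  shows "weight_act w (\<Lambda> 0) = \<Lambda> 0 + (\<Sum>p\<in>I. v_wt p) - (\<Sum>y\<in>J. v_wt y)"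
proof (rule poly_mapping_eqI)
  fix k
  have v: "Poly_Mapping.lookup (v_wt p) k = (if p = k then 1 else 0) - (if p = k + 1 then 1 else 0)" for p
    by (auto simp: v_wt_def lookup_minus)
  have s: "Poly_Mapping.lookup (\<Sum>p\<in>A. v_wt p) k = of_bool (k \<in> A) - of_bool (k + 1 \<in> A)" if "finite A" for A
    using that by (simp add: lookup_sum v sum_subtractf sum.delta)
  show "Poly_Mapping.lookup (weight_act w (\<Lambda> 0)) k
      = Poly_Mapping.lookup (\<Lambda> 0 + (\<Sum>p\<in>I. v_wt p) - (\<Sum>y\<in>J. v_wt y)) k"
    unfolding lookup_weight_act lookup_add lookup_minus lookup_Lambda s[OF assms(1)] s[OF assms(2)]
    unfolding assms(3,4) by auto
qed

text \<open>This is the monomial \<open>tau_monomial (v_wt i)\<close>, the contribution of a single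
  bead.\<close>

definition tau_ratio :: "int \<Rightarrow> ratfun" where
  "tau_ratio i = \<tau> i / \<tau> (i - 1)"

lemma phi_eq:
  assumes "frobenius_lists (maya w) xs ys"
  shows "phi w = act w (\<tau> 0) * (\<Prod>y\<in>set ys. tau_ratio y) / (\<tau> 0 * (\<Prod>p\<in>set xs. tau_ratio p))"
proof -
  have "weight_act w (\<Lambda> 0) = \<Lambda> 0 + (\<Sum>p\<in>set xs. v_wt p) - (\<Sum>y\<in>set ys. v_wt y)"
    by (rule weight_act_eq[OF finite_set finite_set]) (use assms in \<open>simp_all only: frobenius_lists_def\<close>)
  then show ?thesis
    using tau_monomial_Lambda[of 0]
    by (simp add: phi_def tau_monomial_def[symmetric] tau_monomial_add tau_monomial_diff tau_monomial_sum
      v_wt_def tau_ratio_def)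
qed

text \<open>After division by the Cauchy determinant and the normalization, the remaining factors
  each depend on one label and are absorbed into the rows and columns.\<close>

lemma phi_tilde_eq_list_det:
  assumes "frobenius_lists (maya w) xs ys" "sorted_wrt (>) xs" "sorted_wrt (<) ys"
  shows "phi_tilde w = list_det (\<lambda>p y. 1 / (tau_ratio p * arm_factor p) * (tau_ratio y / leg_factor y)
    * hook_entry p y) xs ys"
proof -
  obtain xs' ys' where "frobenius_lists (maya w) xs' ys'" "tau_formula (act w (\<tau> 0)) xs' ys'"
    using act_tau_formula by blast
  from tau_formula_permute[OF this(1) assms(1) this(2)]
  have f: "act w (\<tau> 0) * list_det cauchy_entry xs ys = \<tau> 0 * list_det hook_entry xs ys"
    by (simp add: tau_formula_def)
  let ?N = "hook_factor (partition_of w)" and ?C = "list_det cauchy_entry xs ys"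
  let ?A = "\<Prod>b\<in>set xs. arm_factor b" and ?L = "\<Prod>a\<in>set ys. leg_factor a"
  note N = hook_factor_list_det[OF assms]
  have nz: "?A \<noteq> 0" "?L \<noteq> 0" by (simp_all add: prod_zero_iff arm_factor_nonzero leg_factor_nonzero)
  with N have NC: "?N \<noteq> 0" "?C \<noteq> 0" by auto
  have l: "length xs = length ys" "distinct xs" "distinct ys" using assms(1) by (simp_all add: frobenius_lists_def)
  let ?T = "(\<Prod>y\<in>set ys. tau_ratio y) / (\<Prod>p\<in>set xs. tau_ratio p)"
  have "act w (\<tau> 0) / \<tau> 0 = list_det hook_entry xs ys / ?C"
    using f NC by (simp add: frac_eq_eq mult_ac)
  then have "phi_tilde w = list_det hook_entry xs ys / ?C * ?T / ?N"
    unfolding phi_tilde_def phi_eq[OF assms(1)] by (metis times_divide_times_eq)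
  also have "\<dots> = list_det hook_entry xs ys * ?T / (?N * ?C)" by simp
  also have "\<dots> = prod_list (map (\<lambda>p. 1 / (tau_ratio p * arm_factor p)) xs)
      * prod_list (map (\<lambda>y. tau_ratio y / leg_factor y) ys) * list_det hook_entry xs ys"
    unfolding N using l by (simp add: prod.distinct_set_conv_list[symmetric] prod_dividef prod.distrib mult_ac)
  also have "\<dots> = list_det (\<lambda>p y. 1 / (tau_ratio p * arm_factor p) * (tau_ratio y / leg_factor y)
    * hook_entry p y) xs ys"
    by (rule list_det_scale[symmetric]) (rule l(1))
  finally show ?thesis .
qed

section \<open>Hooks and the determinant formula\<close>

lemma maya_hook:
  assumes "1 \<le> p" "0 \<le> q"
  shows "maya (hook p q) = insert p ({..0} - {- q})"
  using assms(2)
proof (induction q rule: int_ge_induct)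
  case base
  show ?case
    using assms(1)
  proof (induction p rule: int_ge_induct)
    case base
    have "hook 1 0 = sgen 0 * 1" by (simp add: hook_def)
    then show ?case using image_adj_swap_up[of 0 "{..0}"] by (simp only: maya_sgen maya_one) simp
  next
    case (step p)
    have "[0..p] = [0..p - 1] @ [p]" using upto_rec2[of 0 p] step(1) by simp
    then have "hook (p + 1) 0 = sgen p * hook p 0" by (simp add: hook_def)
    then show ?case
      using step image_adj_swap_up[of p "insert p ({..0} - {0})"] by (auto simp: maya_sgen)
  qed
next
  case (step q)
  have "[- (q + 1)..-1] = (- q - 1) # [- q..-1]" using upto_rec1[of "- q - 1" "-1"] step(1) by simp
  then have "hook p (q + 1) = sgen (- q - 1) * hook p q" by (simp add: hook_def mult.assoc)
  \<comment> \<open>The bead at \<open>- q - 1\<close> moves up into the hole \<open>- q\<close>, so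
    the hole moves down by one.\<close>
  then show ?case
    using step assms(1) image_adj_swap_up[of "- q - 1" "insert p ({..0} - {- q})"] by (auto simp: maya_sgen)
qed

lemma phi_tilde_hook:
  assumes "1 \<le> p" "y \<le> 0"
  shows "phi_tilde (hook p (- y)) = 1 / (tau_ratio p * arm_factor p) * (tau_ratio y / leg_factor y) * hook_entry p y"
proof -
  have "frobenius_lists (maya (hook p (- y))) [p] [y]"
    using assms by (auto simp: frobenius_lists_def maya_hook)
  from phi_tilde_eq_list_det[OF this] show ?thesis by simp
qed

theorem theorem1:
  fixes w :: weyl and \<mu> :: "nat list"
  assumes "\<mu> = partition_of w"
  shows "phi_tilde w =
    det (mat (durfee \<mu>) (durfee \<mu>)
      (\<lambda>(a, b). phi_tilde (hook (frob_arm \<mu> (a + 1)) (frob_leg \<mu> (b + 1)))))"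
proof -
  have \<mu>: "is_partition \<mu>" "beads \<mu> = maya w" using assms partition_of_maya by auto
  define xs where "xs = map (frob_arm \<mu>) [1..<durfee \<mu> + 1]"
  \<comment> \<open>The legs decrease with \<open>n\<close>, so their negatives list the holes in
    the increasing order required for Cauchy's determinant.\<close>
  define ys where "ys = map (\<lambda>n. - frob_leg \<mu> n) [1..<durfee \<mu> + 1]"
  have sx: "sorted_wrt (>) xs"
    using frob_arm_strict[OF \<mu>(1)] by (auto simp: xs_def sorted_wrt_iff_nth_less simp del: upt_Suc)
  have sy: "sorted_wrt (<) ys"
    using frob_leg_strict[OF \<mu>(1)] by (auto simp: ys_def sorted_wrt_iff_nth_less simp del: upt_Suc)
  have upt: "{1..<durfee \<mu> + 1} = {1..durfee \<mu>}" by auto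
  have s: "set xs = maya w \<inter> {0<..}" "set ys = {..0} - maya w"
    using frob_arm_image[OF \<mu>(1)] frob_leg_image[OF \<mu>(1)] unfolding xs_def ys_def set_map set_upt upt \<mu>(2) by simp_all
  have "distinct xs" "distinct ys"
    using sx sy sorted_wrt_distinct[of "(>)" xs] sorted_wrt_distinct[of "(<)" ys] by auto
  then have fl: "frobenius_lists (maya w) xs ys" using s by (simp add: frobenius_lists_def xs_def ys_def)
  have "phi_tilde w = list_det (\<lambda>p y. 1 / (tau_ratio p * arm_factor p) * (tau_ratio y / leg_factor y)
      * hook_entry p y) xs ys"
    using fl sx sy by (rule phi_tilde_eq_list_det)
  \<comment> \<open>The same formula for one-element lists identifies each rescaled entry as the
    normalized function of a hook.\<close>
  also have "\<dots> = list_det (\<lambda>p y. phi_tilde (hook p (- y))) xs ys"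
    using s by (intro list_det_cong) (auto simp: phi_tilde_hook xs_def ys_def)
  also have "\<dots> = det (mat (durfee \<mu>) (durfee \<mu>)
      (\<lambda>(a, b). phi_tilde (hook (frob_arm \<mu> (a + 1)) (frob_leg \<mu> (b + 1)))))"
    unfolding list_det_def
    by (rule arg_cong[where f = det], rule cong_mat) (auto simp: xs_def ys_def simp del: upt_Suc)
  finally show ?thesis .
qed

end
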